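(* Feuerbach's theorem holds in any Hilbert plane satisfying the parallel postulate; equivalently, it holds in the cartesian plane $F^2$ over any ordered Pythagorean field $F$. That is: if $ABC$ is a triangle in such a plane that is not equilateral, then the nine-point circle of $ABC$ is tangent to the incircle of $ABC$ and to each of the three excircles of $ABC$.
   Context: A Hilbert plane is a set of points and lines satisfying Hilbert's basic group of 13 axioms of incidence, betweenness and congruence. A Hilbert plane satisfying the parallel postulate is isomorphic to the cartesian plane $F^2$ over an ordered Pythagorean field $F$. An ordered field is a field $F$ with a set $\mathcal{P}$ of positive elements, closed under addition and multiplication, such that for every $a\in F$ exactly one of $a\in\mathcal{P}$, $a=0$, $-a\in\mathcal{P}$ holds; $F$ is Pythagorean if $\sqrt{1+a^2}\in F$ for every $a\in F$. In $F^2$, lines, betweenness, distance, perpendicularity and circles are defined by the usual cartesian formulas. The nine-point circle of $ABC$ is the circle through the midpoints of the sides, the feet of the altitudes, and the midpoints of the segments joining the orthocenter to the vertices. The incircle is the circle internally tangent to the three sides. The excircle opposite a vertex is the circle tangent to the opposite side at a point between its endpoints and to the extensions of the other two sides. Two circles are tangent if they have a common point at which they have the same tangent line. *)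

theory Defs
  imports Main
begin

text \<open>
  The library class \<open>linordered_field\<close> is the notion of an ordered field; its set of
  positive elements is \<open>{x. 0 < x}\<close>. The additional axiom says that \<open>1 + a\<^sup>2\<close> has a
  square root in the field for every \<open>a\<close>.
\<close>

class ordered_pythagorean_field = linordered_field +
  assumes pythagorean: "\<exists>s. s ^ 2 = 1 + a ^ 2"

type_synonym 'a point = "'a \<times> 'a"

definition line_eq :: "'a::linordered_field \<Rightarrow> 'a \<Rightarrow> 'a \<Rightarrow> 'a point set" where
  "line_eq a b c = {(x, y). a * x + b * y + c = 0}"

definition is_line :: "'a::linordered_field point set \<Rightarrow> bool" where
  "is_line L \<longleftrightarrow> (\<exists>a b c. (a \<noteq> 0 \<or> b \<noteq> 0) \<and> L = line_eq a b c)"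

text \<open>The line through two points; only meaningful (and only used) for distinct points.\<close>

definition line :: "'a::linordered_field point \<Rightarrow> 'a point \<Rightarrow> 'a point set" where
  "line P Q = (THE L. is_line L \<and> P \<in> L \<and> Q \<in> L)"

definition perpendicular :: "'a::linordered_field point set \<Rightarrow> 'a point set \<Rightarrow> bool" where
  "perpendicular L M \<longleftrightarrow>
     (\<exists>a b c a' b' c'. (a \<noteq> 0 \<or> b \<noteq> 0) \<and> (a' \<noteq> 0 \<or> b' \<noteq> 0) \<and>
        L = line_eq a b c \<and> M = line_eq a' b' c' \<and> a * a' + b * b' = 0)"

text \<open>\<open>between P Q R\<close>: the point \<open>Q\<close> lies strictly between \<open>P\<close> and \<open>R\<close>.\<close>

definition between :: "'a::linordered_field point \<Rightarrow> 'a point \<Rightarrow> 'a point \<Rightarrow> bool" where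
  "between P Q R \<longleftrightarrow>
     P \<noteq> R \<and> (\<exists>t. 0 < t \<and> t < 1 \<and>
       fst Q = fst P + t * (fst R - fst P) \<and>
       snd Q = snd P + t * (snd R - snd P))"

text \<open>
  The nonnegative square root of the sum of squares. It exists because
  \<open>u\<^sup>2 + v\<^sup>2 = u\<^sup>2 * (1 + (v/u)\<^sup>2)\<close> for \<open>u \<noteq> 0\<close>.
\<close>

definition distance :: "'a::ordered_pythagorean_field point \<Rightarrow> 'a point \<Rightarrow> 'a" where
  "distance P Q = (THE d. 0 \<le> d \<and> d ^ 2 = (fst P - fst Q) ^ 2 + (snd P - snd Q) ^ 2)"

definition circle :: "'a::ordered_pythagorean_field point \<Rightarrow> 'a \<Rightarrow> 'a point set" where
  "circle Z r = {P. distance Z P = r}"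

definition is_circle :: "'a::ordered_pythagorean_field point set \<Rightarrow> bool" where
  "is_circle \<gamma> \<longleftrightarrow> (\<exists>Z r. 0 < r \<and> \<gamma> = circle Z r)"

definition tangent_line_at ::
    "'a::ordered_pythagorean_field point set \<Rightarrow> 'a point set \<Rightarrow> 'a point \<Rightarrow> bool" where
  "tangent_line_at L \<gamma> P \<longleftrightarrow> is_line L \<and> L \<inter> \<gamma> = {P}"

text \<open>``Two circles'' means two different circles: a circle is not tangent to itself.\<close>

definition tangent_circles ::
    "'a::ordered_pythagorean_field point set \<Rightarrow> 'a point set \<Rightarrow> bool" where
  "tangent_circles \<gamma> \<delta> \<longleftrightarrow>
     is_circle \<gamma> \<and> is_circle \<delta> \<and> \<gamma> \<noteq> \<delta> \<and>
     (\<exists>P L. P \<in> \<gamma> \<and> P \<in> \<delta> \<and> tangent_line_at L \<gamma> P \<and> tangent_line_at L \<delta> P)"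

definition triangle :: "'a::linordered_field point \<Rightarrow> 'a point \<Rightarrow> 'a point \<Rightarrow> bool" where
  "triangle A B C \<longleftrightarrow> \<not> (\<exists>L. is_line L \<and> A \<in> L \<and> B \<in> L \<and> C \<in> L)"

definition equilateral ::
    "'a::ordered_pythagorean_field point \<Rightarrow> 'a point \<Rightarrow> 'a point \<Rightarrow> bool" where
  "equilateral A B C \<longleftrightarrow> distance A B = distance B C \<and> distance B C = distance C A"

definition midpoint :: "'a::linordered_field point \<Rightarrow> 'a point \<Rightarrow> 'a point" where
  "midpoint P Q = ((fst P + fst Q) / 2, (snd P + snd Q) / 2)"

text \<open>In \<open>altitude A B C\<close> and \<open>altitude_foot A B C\<close> the vertex is \<open>A\<close>, the opposite side \<open>BC\<close>.\<close>

definition altitude ::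
    "'a::linordered_field point \<Rightarrow> 'a point \<Rightarrow> 'a point \<Rightarrow> 'a point set" where
  "altitude A B C = (THE L. is_line L \<and> A \<in> L \<and> perpendicular L (line B C))"

definition altitude_foot ::
    "'a::linordered_field point \<Rightarrow> 'a point \<Rightarrow> 'a point \<Rightarrow> 'a point" where
  "altitude_foot A B C = (THE D. D \<in> altitude A B C \<and> D \<in> line B C)"

definition orthocenter ::
    "'a::linordered_field point \<Rightarrow> 'a point \<Rightarrow> 'a point \<Rightarrow> 'a point" where
  "orthocenter A B C =
     (THE H. H \<in> altitude A B C \<and> H \<in> altitude B C A \<and> H \<in> altitude C A B)"

text \<open>
  If the triangle has a right angle, its orthocenter is a vertex, and the midpoint of the
  degenerate segment joining the two is that vertex.
\<close>

definition nine_point_circle ::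
    "'a::ordered_pythagorean_field point \<Rightarrow> 'a point \<Rightarrow> 'a point \<Rightarrow> 'a point set" where
  "nine_point_circle A B C =
     (THE \<gamma>. is_circle \<gamma> \<and>
        midpoint B C \<in> \<gamma> \<and> midpoint C A \<in> \<gamma> \<and> midpoint A B \<in> \<gamma> \<and>
        altitude_foot A B C \<in> \<gamma> \<and> altitude_foot B C A \<in> \<gamma> \<and> altitude_foot C A B \<in> \<gamma> \<and>
        midpoint (orthocenter A B C) A \<in> \<gamma> \<and>
        midpoint (orthocenter A B C) B \<in> \<gamma> \<and>
        midpoint (orthocenter A B C) C \<in> \<gamma>)"

definition inside_triangle ::
    "'a::linordered_field point \<Rightarrow> 'a point \<Rightarrow> 'a point \<Rightarrow> 'a point \<Rightarrow> bool" where
  "inside_triangle P A B C \<longleftrightarrow> (\<exists>D. between B D C \<and> between A P D)"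

text \<open>
  Internal tangency: the center is inside the triangle and each point of tangency lies
  strictly between the endpoints of its side.
\<close>

definition incircle ::
    "'a::ordered_pythagorean_field point \<Rightarrow> 'a point \<Rightarrow> 'a point \<Rightarrow> 'a point set" where
  "incircle A B C =
     (THE \<gamma>. (\<exists>Z r. 0 < r \<and> \<gamma> = circle Z r \<and> inside_triangle Z A B C) \<and>
        (\<exists>D. between B D C \<and> tangent_line_at (line B C) \<gamma> D) \<and>
        (\<exists>E. between C E A \<and> tangent_line_at (line C A) \<gamma> E) \<and>
        (\<exists>F. between A F B \<and> tangent_line_at (line A B) \<gamma> F))"

text \<open>
  The excircle opposite the vertex \<open>A\<close>; it touches the sides \<open>AB\<close> and \<open>AC\<close> extended
  beyond \<open>B\<close> and \<open>C\<close>.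
\<close>

definition excircle ::
    "'a::ordered_pythagorean_field point \<Rightarrow> 'a point \<Rightarrow> 'a point \<Rightarrow> 'a point set" where
  "excircle A B C =
     (THE \<gamma>. is_circle \<gamma> \<and>
        (\<exists>D. between B D C \<and> tangent_line_at (line B C) \<gamma> D) \<and>
        (\<exists>E. between A C E \<and> tangent_line_at (line A C) \<gamma> E) \<and>
        (\<exists>F. between A B F \<and> tangent_line_at (line A B) \<gamma> F))"

end

theory Submission
  imports Defs
begin

text \<open>
  Let \<open>a, b, c\<close> be side lengths taken with signs, \<open>s = a + b + c\<close>, and let \<open>\<Delta>\<close> be twice the
  signed area. With all signs positive, \<open>I = (a A + b B + c C) / s\<close> is the incenter and
  \<open>\<Delta> / s\<close> is, up to sign, the inradius; changing the sign of one length turns these into the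
  center and the radius of the opposite excircle, so one computation covers all four circles.
  With the circumcenter \<open>O\<close> as origin, the nine-point center is \<open>N = (A + B + C) / 2\<close>, and the
  nine-point radius is \<open>\<rho> = a b c / (4 \<Delta>)\<close> up to sign. Inner products of the vertices are
  expressible by \<open>a, b, c\<close> and the circumradius, and Heron's formula turns \<open>|N - I|\<^sup>2\<close> into
  \<open>(\<rho> - \<Delta> / s)\<^sup>2\<close>, which is tangency unless \<open>\<rho> = \<Delta> / s\<close>.
\<close>

section \<open>Lines and circles in coordinates\<close>

text \<open>The one place where the axiom \<open>pythagorean\<close> enters; everything later about
  lengths rests on it through \<open>distance_properties\<close>.\<close>

lemma sqrt_sum_squares_exists:
  "\<exists>d::'a::ordered_pythagorean_field. 0 \<le> d \<and> d ^ 2 = u ^ 2 + v ^ 2"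
proof (cases "u = 0")
  case True
  then show ?thesis by (intro exI[of _ "\<bar>v\<bar>"]) simp
next
  case False
  obtain t where t: "t ^ 2 = 1 + (v / u) ^ 2"
    using pythagorean by blast
  have "\<bar>u * t\<bar> ^ 2 = u ^ 2 + v ^ 2"
    using False by (simp add: power_mult_distrib t power_divide field_simps)
  then show ?thesis by (intro exI[of _ "\<bar>u * t\<bar>"]) simp
qed

lemma distance_properties:
  fixes P Q :: "'a::ordered_pythagorean_field point"
  shows "0 \<le> distance P Q \<and> distance P Q ^ 2 = (fst P - fst Q) ^ 2 + (snd P - snd Q) ^ 2"
  unfolding distance_def
proof (rule theI')
  show "\<exists>!d. 0 \<le> d \<and> d ^ 2 = (fst P - fst Q) ^ 2 + (snd P - snd Q) ^ 2"
    using sqrt_sum_squares_exists[of "fst P - fst Q" "snd P - snd Q"]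
    by (metis power2_eq_iff_nonneg)
qed

lemma mem_circle:
  fixes r :: "'a::ordered_pythagorean_field"
  assumes "0 \<le> r"
  shows "(x, y) \<in> circle (z, w) r \<longleftrightarrow> (z - x) ^ 2 + (w - y) ^ 2 = r ^ 2"
proof -
  have "distance (z, w) (x, y) = r \<longleftrightarrow> distance (z, w) (x, y) ^ 2 = r ^ 2"
    using assms distance_properties[of "(z, w)" "(x, y)"] by (metis power2_eq_iff_nonneg)
  then show ?thesis
    using distance_properties[of "(z, w)" "(x, y)"] by (simp add: circle_def)
qed

section \<open>Equations of lines and nondegenerate triangles\<close>

text \<open>Cramer's rule. Uniqueness of altitude feet, of the orthocenter and of circle centers is
  reduced to it: the difference of two candidates is orthogonal to two independent vectors.\<close>

lemma orthogonal_to_independent_eq_0: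
  fixes w1 w2 u1 u2 v1 v2 :: "'a::linordered_field"
  assumes "w1 * u1 + w2 * u2 = 0" "w1 * v1 + w2 * v2 = 0" "u1 * v2 - u2 * v1 \<noteq> 0"
  shows "w1 = 0" "w2 = 0"
proof -
  have "w1 * (u1 * v2 - u2 * v1) = 0" "w2 * (u1 * v2 - u2 * v1) = 0"
    using assms(1,2) by algebra+
  then show "w1 = 0" "w2 = 0" using assms(3) by auto
qed

lemma mem_line_eq: "(x, y) \<in> line_eq a b c \<longleftrightarrow> a * x + b * y + c = 0"
  by (simp add: line_eq_def)

text \<open>Elimination shows that both \<open>a\<close> and \<open>b\<close> annihilate the cross
  product. With the converse \<open>coefficients_through\<close>, this describes a line by two of
  its points, independently of the chosen coefficients.\<close>

lemma coefficients_cross: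
  fixes a b c :: "'a::linordered_field"
  assumes "a * p1 + b * p2 + c = 0" "a * q1 + b * q2 + c = 0"
    and "a * x + b * y + c = 0" and "a \<noteq> 0 \<or> b \<noteq> 0"
  shows "(x - p1) * (q2 - p2) = (y - p2) * (q1 - p1)"
proof -
  have "a * ((x - p1) * (q2 - p2) - (y - p2) * (q1 - p1)) = 0"
    "b * ((x - p1) * (q2 - p2) - (y - p2) * (q1 - p1)) = 0"
    using assms(1-3) by algebra+
  then show ?thesis using assms(4) by auto
qed

lemma coefficients_through:
  fixes a b c :: "'a::linordered_field"
  assumes "a * p1 + b * p2 + c = 0" "a * q1 + b * q2 + c = 0"
    and "(x - p1) * (q2 - p2) = (y - p2) * (q1 - p1)" and "(p1, p2) \<noteq> (q1, q2)"
  shows "a * x + b * y + c = 0"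
proof -
  have "(q1 - p1) * (a * x + b * y + c) = 0" "(q2 - p2) * (a * x + b * y + c) = 0"
    using assms(1-3) by algebra+
  then show ?thesis using assms(4) by auto
qed

text \<open>Every line through two distinct points is this one set, which settles uniqueness in the
  definite description \<open>line\<close>.\<close>

lemma line_eqI:
  fixes L :: "'a::linordered_field point set"
  assumes "is_line L" "(p1, p2) \<in> L" "(q1, q2) \<in> L" "(p1, p2) \<noteq> (q1, q2)"
  shows "L = {(x, y). (x - p1) * (q2 - p2) = (y - p2) * (q1 - p1)}"
proof -
  obtain a b c where L: "L = line_eq a b c" and nz: "a \<noteq> 0 \<or> b \<noteq> 0"
    using assms(1) unfolding is_line_def by blast
  have "a * p1 + b * p2 + c = 0" "a * q1 + b * q2 + c = 0"
    using assms(2,3) unfolding L mem_line_eq by auto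
  then show ?thesis
    unfolding L line_eq_def
    using coefficients_cross[OF _ _ _ nz] coefficients_through[OF _ _ _ assms(4)] by blast
qed

lemma is_line_through:
  fixes p1 p2 q1 q2 :: "'a::linordered_field"
  assumes "(p1, p2) \<noteq> (q1, q2)"
  shows "is_line {(x, y). (x - p1) * (q2 - p2) = (y - p2) * (q1 - p1)}"
    (is "is_line ?L")
proof -
  have "?L = line_eq (q2 - p2) (p1 - q1) (p2 * (q1 - p1) - p1 * (q2 - p2))"
    unfolding line_eq_def by (auto simp: algebra_simps)
  moreover have "q2 - p2 \<noteq> 0 \<or> p1 - q1 \<noteq> 0"
    using assms by auto
  ultimately show ?thesis unfolding is_line_def by blast
qed

lemma line_coordinates:
  fixes p1 p2 q1 q2 :: "'a::linordered_field"
  assumes "(p1, p2) \<noteq> (q1, q2)"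
  shows "line (p1, p2) (q1, q2) = {(x, y). (x - p1) * (q2 - p2) = (y - p2) * (q1 - p1)}"
  unfolding line_def
proof (rule the_equality)
  show "is_line {(x, y). (x - p1) * (q2 - p2) = (y - p2) * (q1 - p1)} \<and>
    (p1, p2) \<in> {(x, y). (x - p1) * (q2 - p2) = (y - p2) * (q1 - p1)} \<and>
    (q1, q2) \<in> {(x, y). (x - p1) * (q2 - p2) = (y - p2) * (q1 - p1)}"
    using is_line_through[OF assms] by (simp add: mult.commute)
qed (use line_eqI assms in blast)

lemma line_commute: "line P Q = line Q P"
  unfolding line_def by (simp add: conj_ac)

lemma is_line_line:
  fixes p1 p2 q1 q2 :: "'a::linordered_field"
  assumes "(p1, p2) \<noteq> (q1, q2)"
  shows "is_line (line (p1, p2) (q1, q2))"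
  using is_line_through[OF assms] line_coordinates[OF assms] by simp

text \<open>The determinant is twice the signed area, the quantity \<Delta> of all later
  computations.\<close>

lemma triangle_coordinates:
  fixes x1 y1 x2 y2 x3 y3 :: "'a::linordered_field"
  shows "triangle (x1, y1) (x2, y2) (x3, y3) \<longleftrightarrow>
    (x2 - x1) * (y3 - y1) - (y2 - y1) * (x3 - x1) \<noteq> 0" (is "_ \<longleftrightarrow> ?\<Delta> \<noteq> 0")
proof
  assume tri: "triangle (x1, y1) (x2, y2) (x3, y3)"
  show "?\<Delta> \<noteq> 0"
  proof
    assume 0: "?\<Delta> = 0"
    have not_on: "\<not> ((x1, y1) \<in> L \<and> (x2, y2) \<in> L \<and> (x3, y3) \<in> L)" if "is_line L" for L
      using tri that unfolding triangle_def by blast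
    consider "(x1, y1) \<noteq> (x2, y2)" | "(x1, y1) = (x2, y2)" "(x1, y1) \<noteq> (x3, y3)"
      | "(x1, y1) = (x2, y2)" "(x1, y1) = (x3, y3)" by blast
    then show False
    proof cases
      case 1
      have "(x3 - x1) * (y2 - y1) = (y3 - y1) * (x2 - x1)"
        using 0 by (simp add: mult.commute)
      then show False
        using not_on[OF is_line_through[OF 1]] by (simp add: mult.commute)
    next
      case 2
      then show False
        using not_on[OF is_line_through[OF 2(2)]] by (simp add: mult.commute)
    next
      case 3
      \<comment> \<open>All three vertices coincide here, so any line through that point will do;
        the horizontal one is taken.\<close>
      have "(x1, y1) \<noteq> (x1 + 1, y1)" by simp
      from not_on[OF is_line_through[OF this]] 3 show False by simp
    qed
  qed
next
  assume nz: "?\<Delta> \<noteq> 0"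
  show "triangle (x1, y1) (x2, y2) (x3, y3)"
    unfolding triangle_def
  proof (rule notI, elim exE conjE)
    fix L assume L: "is_line L" "(x1, y1) \<in> L" "(x2, y2) \<in> L" "(x3, y3) \<in> L"
    have "(x1, y1) \<noteq> (x2, y2)" using nz by auto
    from line_eqI[OF L(1-3) this] L(4) nz show False
      by (simp add: mult.commute)
  qed
qed

section \<open>Tangent lines and tangent circles\<close>

text \<open>Replaces the one-point definition of tangency by polynomial equations: the contact point
  is on the line and on the circle, and the radius to it is perpendicular to the line.\<close>

lemma tangent_line_at_circle_iff:
  fixes r :: "'a::ordered_pythagorean_field"
  assumes "(p1, p2) \<noteq> (q1, q2)" "0 \<le> r"
  shows "tangent_line_at (line (p1, p2) (q1, q2)) (circle (z, w) r) (d1, d2) \<longleftrightarrow>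
    (d1 - p1) * (q2 - p2) = (d2 - p2) * (q1 - p1) \<and>
    (z - d1) ^ 2 + (w - d2) ^ 2 = r ^ 2 \<and>
    (z - d1) * (q1 - p1) + (w - d2) * (q2 - p2) = 0" (is "?L \<longleftrightarrow> ?on \<and> ?dist \<and> ?perp")
proof
  assume ?L
  then have int: "line (p1, p2) (q1, q2) \<inter> circle (z, w) r = {(d1, d2)}"
    by (simp add: tangent_line_at_def)
  then have mem: "(d1, d2) \<in> line (p1, p2) (q1, q2)" "(d1, d2) \<in> circle (z, w) r" by auto
  have on: ?on using mem(1) unfolding line_coordinates[OF assms(1)] by simp
  have di: ?dist using mem(2) unfolding mem_circle[OF assms(2)] .
  define m n where "m = q1 - p1" and "n = q2 - p2"
  have mn: "m ^ 2 + n ^ 2 \<noteq> 0"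
    using assms(1) by (auto simp: m_def n_def sum_power2_eq_zero_iff)
  \<comment> \<open>The root besides \<open>0\<close> of the quadratic in \<open>k\<close> saying
    that \<open>(d1 + k * m, d2 + k * n)\<close> is on the circle; the two roots coincide exactly if
    the radius is perpendicular.\<close>
  define k where "k = 2 * ((z - d1) * m + (w - d2) * n) / (m ^ 2 + n ^ 2)"
  have k: "k * (m ^ 2 + n ^ 2) = 2 * ((z - d1) * m + (w - d2) * n)"
    using mn by (simp add: k_def)
  \<comment> \<open>the second intersection point of the line with the circle\<close>
  have "(d1 + k * m, d2 + k * n) \<in> line (p1, p2) (q1, q2)"
    unfolding line_coordinates[OF assms(1)] using on by (simp add: m_def n_def algebra_simps)
  moreover have "(d1 + k * m, d2 + k * n) \<in> circle (z, w) r"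
    unfolding mem_circle[OF assms(2)] di[symmetric] using k by algebra
  ultimately have "(d1 + k * m, d2 + k * n) = (d1, d2)"
    using int by blast
  then have "k = 0" using mn by auto
  then have ?perp using k by (simp add: m_def n_def)
  with on di show "?on \<and> ?dist \<and> ?perp" by blast
next
  assume R: "?on \<and> ?dist \<and> ?perp"
  have "line (p1, p2) (q1, q2) \<inter> circle (z, w) r \<subseteq> {(d1, d2)}"
  proof
    fix X assume X: "X \<in> line (p1, p2) (q1, q2) \<inter> circle (z, w) r"
    obtain x y where xy: "X = (x, y)" by fastforce
    have 1: "(x - p1) * (q2 - p2) = (y - p2) * (q1 - p1)"
      using X unfolding xy line_coordinates[OF assms(1)] by simp
    have 2: "(z - x) ^ 2 + (w - y) ^ 2 = r ^ 2"
      using X mem_circle[OF assms(2)] unfolding xy by blast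
    \<comment> \<open>The vector from the contact point to \<open>X\<close> runs along the line,
      hence is orthogonal to the radius; by Pythagoras, equal distances from the center then force
      it to vanish.\<close>
    have "(q1 - p1) * ((x - d1) * (z - d1) + (y - d2) * (w - d2)) = 0"
      "(q2 - p2) * ((x - d1) * (z - d1) + (y - d2) * (w - d2)) = 0"
      using R 1 by algebra+
    then have "(x - d1) * (z - d1) + (y - d2) * (w - d2) = 0"
      using assms(1) by auto
    then have "(x - d1) ^ 2 + (y - d2) ^ 2 = 0"
      using R 2 by algebra
    then show "X \<in> {(d1, d2)}" by (simp add: xy sum_power2_eq_zero_iff)
  qed
  moreover have "(d1, d2) \<in> line (p1, p2) (q1, q2) \<inter> circle (z, w) r"
    using R mem_circle[OF assms(2)] line_coordinates[OF assms(1)] by auto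
  ultimately show ?L
    unfolding tangent_line_at_def using is_line_line[OF assms(1)] by blast
qed

text \<open>Signed radii: equal signs give internal tangency, opposite signs external tangency.\<close>

lemma tangent_circlesI:
  fixes \<rho> \<sigma> :: "'a::ordered_pythagorean_field"
  assumes "(n1 - i1) ^ 2 + (n2 - i2) ^ 2 = (\<rho> - \<sigma>) ^ 2" "\<rho> \<noteq> 0" "\<sigma> \<noteq> 0" "\<rho> \<noteq> \<sigma>"
  shows "tangent_circles (circle (n1, n2) \<bar>\<rho>\<bar>) (circle (i1, i2) \<bar>\<sigma>\<bar>)"
proof -
  \<comment> \<open>A unit vector along the line of centers, oriented so that the second center is
    the first plus \<rho> - \<sigma> times it.\<close>
  define u v where "u = (i1 - n1) / (\<rho> - \<sigma>)" and "v = (i2 - n2) / (\<rho> - \<sigma>)"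
  have i: "i1 = n1 + (\<rho> - \<sigma>) * u" "i2 = n2 + (\<rho> - \<sigma>) * v"
    using assms(4) by (simp_all add: u_def v_def)
  have "(\<rho> - \<sigma>) ^ 2 * (u ^ 2 + v ^ 2) = (\<rho> - \<sigma>) ^ 2 * 1"
    using assms(1) unfolding i by algebra
  then have uv: "u ^ 2 + v ^ 2 = 1" using assms(4) by simp
  \<comment> \<open>The contact point: it is also
    \<open>(i1 + \<sigma> * u, i2 + \<sigma> * v)\<close>. The common tangent leaves it in the
    direction \<open>(- v, u)\<close>.\<close>
  define p1 p2 where "p1 = n1 + \<rho> * u" and "p2 = n2 + \<rho> * v"
  have ne: "(p1, p2) \<noteq> (p1 - v, p2 + u)" using uv by auto
  let ?L = "line (p1, p2) (p1 - v, p2 + u)"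
  have T1: "tangent_line_at ?L (circle (n1, n2) \<bar>\<rho>\<bar>) (p1, p2)"
    unfolding tangent_line_at_circle_iff[OF ne abs_ge_zero] unfolding p1_def p2_def power2_abs
    by (intro conjI) (simp, use uv in algebra, simp add: algebra_simps)
  have T2: "tangent_line_at ?L (circle (i1, i2) \<bar>\<sigma>\<bar>) (p1, p2)"
    unfolding tangent_line_at_circle_iff[OF ne abs_ge_zero] unfolding p1_def p2_def power2_abs i
    by (intro conjI) (simp, use uv in algebra, simp add: algebra_simps)
  \<comment> \<open>The antipode of the contact point on the first circle distinguishes the two
    circles.\<close>
  have "(n1 - \<rho> * u, n2 - \<rho> * v) \<in> circle (n1, n2) \<bar>\<rho>\<bar>"
    unfolding mem_circle[OF abs_ge_zero] power2_abs using uv by algebra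
  moreover have "(n1 - \<rho> * u, n2 - \<rho> * v) \<notin> circle (i1, i2) \<bar>\<sigma>\<bar>"
    unfolding mem_circle[OF abs_ge_zero] power2_abs i
  proof
    assume "(n1 + (\<rho> - \<sigma>) * u - (n1 - \<rho> * u)) ^ 2 + (n2 + (\<rho> - \<sigma>) * v - (n2 - \<rho> * v)) ^ 2 = \<sigma> ^ 2"
    then have "4 * (\<rho> * (\<rho> - \<sigma>)) = 0" using uv by algebra
    then show False using assms(2,4) by simp
  qed
  ultimately have "circle (n1, n2) \<bar>\<rho>\<bar> \<noteq> circle (i1, i2) \<bar>\<sigma>\<bar>" by blast
  moreover have "is_circle (circle (n1, n2) \<bar>\<rho>\<bar>)" "is_circle (circle (i1, i2) \<bar>\<sigma>\<bar>)"
    using assms(2,3) zero_less_abs_iff unfolding is_circle_def by blast+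
  moreover have "(p1, p2) \<in> circle (n1, n2) \<bar>\<rho>\<bar>" "(p1, p2) \<in> circle (i1, i2) \<bar>\<sigma>\<bar>"
    using T1 T2 unfolding tangent_line_at_def by blast+
  ultimately show ?thesis
    unfolding tangent_circles_def using T1 T2 by blast
qed

section \<open>The nine-point circle\<close>

lemma altitude_coordinates:
  fixes x1 y1 x2 y2 x3 y3 :: "'a::linordered_field"
  assumes "(x2, y2) \<noteq> (x3, y3)"
  shows "altitude (x1, y1) (x2, y2) (x3, y3) =
    {(x, y). (x - x1) * (x3 - x2) + (y - y1) * (y3 - y2) = 0}" (is "_ = ?M")
proof -
  let ?l = "line_eq (y3 - y2) (x2 - x3) (y2 * (x3 - x2) - x2 * (y3 - y2))"
  let ?m = "line_eq (x3 - x2) (y3 - y2) (- (x1 * (x3 - x2) + y1 * (y3 - y2)))"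
  have nz: "x3 - x2 \<noteq> 0 \<or> y3 - y2 \<noteq> 0" "y3 - y2 \<noteq> 0 \<or> x2 - x3 \<noteq> 0" using assms by auto
  have M: "?M = ?m" unfolding line_eq_def by (auto simp: algebra_simps)
  have l: "line (x2, y2) (x3, y3) = ?l"
    unfolding line_coordinates[OF assms] line_eq_def by (auto simp: algebra_simps)
  show ?thesis unfolding altitude_def
  proof (rule the_equality)
    have "is_line ?M" unfolding M is_line_def using nz by blast
    moreover have "perpendicular ?M (line (x2, y2) (x3, y3))"
      unfolding M l perpendicular_def
      by (intro exI conjI, rule nz(1), rule nz(2), rule refl, rule refl, simp add: algebra_simps)
    ultimately show "is_line ?M \<and> (x1, y1) \<in> ?M \<and> perpendicular ?M (line (x2, y2) (x3, y3))"
      by simp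
  next
    fix L assume L: "is_line L \<and> (x1, y1) \<in> L \<and> perpendicular L (line (x2, y2) (x3, y3))"
    then obtain a b c a' b' c' where ab: "a \<noteq> 0 \<or> b \<noteq> 0" "a' \<noteq> 0 \<or> b' \<noteq> 0"
      and eq: "L = line_eq a b c" "line (x2, y2) (x3, y3) = line_eq a' b' c'"
      and orth: "a * a' + b * b' = 0"
      unfolding perpendicular_def by blast
    have "(x2, y2) \<in> line (x2, y2) (x3, y3)" "(x3, y3) \<in> line (x2, y2) (x3, y3)"
      unfolding line_coordinates[OF assms] by (simp_all add: mult.commute)
    then have on: "a' * x2 + b' * y2 + c' = 0" "a' * x3 + b' * y3 + c' = 0"
      unfolding eq(2) mem_line_eq .
    have A: "a * x1 + b * y1 + c = 0" using L unfolding eq(1) mem_line_eq by simp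
    \<comment> \<open>The side direction and the normal \<open>(a, b)\<close> of \<open>L\<close>
      are both orthogonal to \<open>(a', b')\<close>, hence parallel. This pins down
      \<open>L\<close> although \<open>perpendicular\<close> gives its coefficients only
      existentially.\<close>
    have "a' * (a * (y3 - y2) - b * (x3 - x2)) = 0" "b' * (a * (y3 - y2) - b * (x3 - x2)) = 0"
      using on orth by algebra+
    then have par: "a * (y3 - y2) = b * (x3 - x2)" using ab(2) by auto
    have "a * x + b * y + c = 0 \<longleftrightarrow> (x - x1) * (x3 - x2) + (y - y1) * (y3 - y2) = 0" for x y
    proof
      assume "a * x + b * y + c = 0"
      then have "a * ((x - x1) * (x3 - x2) + (y - y1) * (y3 - y2)) = 0"
        "b * ((x - x1) * (x3 - x2) + (y - y1) * (y3 - y2)) = 0"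
        using A par by algebra+
      then show "(x - x1) * (x3 - x2) + (y - y1) * (y3 - y2) = 0" using ab(1) by auto
    next
      assume "(x - x1) * (x3 - x2) + (y - y1) * (y3 - y2) = 0"
      then have "(x3 - x2) * (a * x + b * y + c) = 0" "(y3 - y2) * (a * x + b * y + c) = 0"
        using A par by algebra+
      then show "a * x + b * y + c = 0" using nz(1) by auto
    qed
    then show "L = ?M" unfolding eq(1) line_eq_def by simp
  qed
qed

text \<open>The quotient formula for the foot stays hidden; later arguments work with the
  perpendicularity and incidence equations.\<close>

lemma altitude_foot_coordinates:
  fixes x1 y1 x2 y2 x3 y3 :: "'a::linordered_field"
  assumes "(x2, y2) \<noteq> (x3, y3)"
  obtains d1 d2 where "altitude_foot (x1, y1) (x2, y2) (x3, y3) = (d1, d2)"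
    and "(d1 - x1) * (x3 - x2) + (d2 - y1) * (y3 - y2) = 0"
    and "(d1 - x2) * (y3 - y2) = (d2 - y2) * (x3 - x2)"
proof -
  define m n where "m = x3 - x2" and "n = y3 - y2"
  have mn: "m ^ 2 + n ^ 2 \<noteq> 0"
    using assms by (auto simp: m_def n_def sum_power2_eq_zero_iff)
  \<comment> \<open>Parameter of the orthogonal projection of the vertex onto the opposite side
    line.\<close>
  define k where "k = ((x1 - x2) * m + (y1 - y2) * n) / (m ^ 2 + n ^ 2)"
  have k: "k * (m ^ 2 + n ^ 2) = (x1 - x2) * m + (y1 - y2) * n"
    using mn by (simp add: k_def)
  define d1 d2 where "d1 = x2 + k * m" and "d2 = y2 + k * n"
  have 1: "(d1 - x1) * m + (d2 - y1) * n = 0" using k unfolding d1_def d2_def by algebra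
  have 2: "(d1 - x2) * n = (d2 - y2) * m" unfolding d1_def d2_def by algebra
  have "altitude_foot (x1, y1) (x2, y2) (x3, y3) = (d1, d2)"
    unfolding altitude_foot_def altitude_coordinates[OF assms] line_coordinates[OF assms]
      m_def[symmetric] n_def[symmetric]
  proof (rule the_equality)
    fix D assume D: "D \<in> {(x, y). (x - x1) * m + (y - y1) * n = 0} \<and>
      D \<in> {(x, y). (x - x2) * n = (y - y2) * m}"
    obtain e1 e2 where e: "D = (e1, e2)" by fastforce
    have "(e1 - d1) * m + (e2 - d2) * n = 0" "(e1 - d1) * n + (e2 - d2) * (- m) = 0"
      using D 1 2 unfolding e by (auto simp: algebra_simps)
    moreover have "m * (- m) - n * n \<noteq> 0" using mn by (simp add: power2_eq_square)
    ultimately have "e1 - d1 = 0" "e2 - d2 = 0"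
      using orthogonal_to_independent_eq_0 by blast+
    then show "D = (d1, d2)" by (simp add: e)
  qed (use 1 2 in simp)
  then show ?thesis using that 1 2 unfolding m_def n_def by blast
qed

text \<open>The point \<open>(o1, o2)\<close> is the circumcenter.\<close>

lemma orthocenter_coordinates:
  fixes x1 y1 x2 y2 x3 y3 :: "'a::linordered_field"
  assumes nz: "(x2 - x1) * (y3 - y1) - (y2 - y1) * (x3 - x1) \<noteq> 0"
    and "(x1 - o1) ^ 2 + (y1 - o2) ^ 2 = R2"
    and "(x2 - o1) ^ 2 + (y2 - o2) ^ 2 = R2"
    and "(x3 - o1) ^ 2 + (y3 - o2) ^ 2 = R2"
  shows "orthocenter (x1, y1) (x2, y2) (x3, y3) =
    (x1 + x2 + x3 - 2 * o1, y1 + y2 + y3 - 2 * o2)"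
proof -
  have ne: "(x2, y2) \<noteq> (x3, y3)" "(x3, y3) \<noteq> (x1, y1)" "(x1, y1) \<noteq> (x2, y2)"
    using nz by (auto simp: algebra_simps)
  define h1 h2 where "h1 = x1 + x2 + x3 - 2 * o1" and "h2 = y1 + y2 + y3 - 2 * o2"
  \<comment> \<open>As a vector from the circumcenter, the orthocenter is the sum of the three
    vertices. Its difference from one vertex is the sum of the other two, which is orthogonal to
    their difference because they have equal length.\<close>
  have h: "(h1 - x1) * (x3 - x2) + (h2 - y1) * (y3 - y2) = 0"
    "(h1 - x2) * (x1 - x3) + (h2 - y2) * (y1 - y3) = 0"
    "(h1 - x3) * (x2 - x1) + (h2 - y3) * (y2 - y1) = 0"
    unfolding h1_def h2_def using assms(3)[folded assms(4)] assms(4)[folded assms(2)]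
      assms(2)[folded assms(3)] by algebra+
  show ?thesis
    unfolding orthocenter_def altitude_coordinates[OF ne(1)] altitude_coordinates[OF ne(2)]
      altitude_coordinates[OF ne(3)] h1_def[symmetric] h2_def[symmetric]
  proof (rule the_equality)
    fix X assume X: "X \<in> {(x, y). (x - x1) * (x3 - x2) + (y - y1) * (y3 - y2) = 0} \<and>
      X \<in> {(x, y). (x - x2) * (x1 - x3) + (y - y2) * (y1 - y3) = 0} \<and>
      X \<in> {(x, y). (x - x3) * (x2 - x1) + (y - y3) * (y2 - y1) = 0}"
    obtain e1 e2 where e: "X = (e1, e2)" by fastforce
    have "(e1 - h1) * (x2 - x1) + (e2 - h2) * (y2 - y1) = 0"
      "(e1 - h1) * (x3 - x1) + (e2 - h2) * (y3 - y1) = 0"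
      using X h unfolding e by (auto simp: algebra_simps)
    then have "e1 - h1 = 0" "e2 - h2 = 0"
      using orthogonal_to_independent_eq_0 nz by blast+
    then show "X = (h1, h2)" by (simp add: e)
  qed (use h in simp)
qed

section \<open>The circumcircle and the nine points\<close>

lemma circumcenter_exists:
  fixes x1 y1 x2 y2 x3 y3 :: "'a::linordered_field"
  assumes nz: "(x2 - x1) * (y3 - y1) - (y2 - y1) * (x3 - x1) \<noteq> 0"
  obtains o1 o2 R2 where "(x1 - o1) ^ 2 + (y1 - o2) ^ 2 = R2"
    and "(x2 - o1) ^ 2 + (y2 - o2) ^ 2 = R2"
    and "(x3 - o1) ^ 2 + (y3 - o2) ^ 2 = R2"
proof -
  define u1 u2 v1 v2 where uv: "u1 = x2 - x1" "u2 = y2 - y1" "v1 = x3 - x1" "v2 = y3 - y1"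
  define \<Delta> where "\<Delta> = u1 * v2 - u2 * v1"
  have \<Delta>: "\<Delta> \<noteq> 0" using nz by (simp add: \<Delta>_def uv)
  \<comment> \<open>With the first vertex as origin, Cramer's rule solves the equations of two
    perpendicular bisectors.\<close>
  define p q where "p = (v2 * (u1 ^ 2 + u2 ^ 2) - u2 * (v1 ^ 2 + v2 ^ 2)) / (2 * \<Delta>)"
    and "q = (u1 * (v1 ^ 2 + v2 ^ 2) - v1 * (u1 ^ 2 + u2 ^ 2)) / (2 * \<Delta>)"
  have pq: "2 * \<Delta> * p = v2 * (u1 ^ 2 + u2 ^ 2) - u2 * (v1 ^ 2 + v2 ^ 2)"
    "2 * \<Delta> * q = u1 * (v1 ^ 2 + v2 ^ 2) - v1 * (u1 ^ 2 + u2 ^ 2)"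
    using \<Delta> by (simp_all add: p_def q_def)
  have "\<Delta> * ((u1 - p) ^ 2 + (u2 - q) ^ 2) = \<Delta> * (p ^ 2 + q ^ 2)"
    "\<Delta> * ((v1 - p) ^ 2 + (v2 - q) ^ 2) = \<Delta> * (p ^ 2 + q ^ 2)"
    using pq unfolding \<Delta>_def by algebra+
  then have "(u1 - p) ^ 2 + (u2 - q) ^ 2 = p ^ 2 + q ^ 2" "(v1 - p) ^ 2 + (v2 - q) ^ 2 = p ^ 2 + q ^ 2"
    using \<Delta> by auto
  then show ?thesis
    using that[of "x1 + p" "y1 + q" "p ^ 2 + q ^ 2"] unfolding uv by (simp add: algebra_simps)
qed

text \<open>The square of the classical relation \<open>a * b * c = 2 * R * \<Delta>\<close> for
  twice the area \<Delta>. It comes from squaring and adding Cramer's formulas for the circumcenter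
  relative to the first vertex.\<close>

lemma circumradius_squared:
  fixes x1 y1 x2 y2 x3 y3 :: "'a::linordered_field"
  assumes "(x1 - o1) ^ 2 + (y1 - o2) ^ 2 = R2"
    and "(x2 - o1) ^ 2 + (y2 - o2) ^ 2 = R2"
    and "(x3 - o1) ^ 2 + (y3 - o2) ^ 2 = R2"
  shows "4 * ((x2 - x1) * (y3 - y1) - (y2 - y1) * (x3 - x1)) ^ 2 * R2 =
    ((x3 - x2) ^ 2 + (y3 - y2) ^ 2) * ((x1 - x3) ^ 2 + (y1 - y3) ^ 2) *
    ((x2 - x1) ^ 2 + (y2 - y1) ^ 2)"
proof -
  define u1 u2 v1 v2 where uv: "u1 = x2 - x1" "u2 = y2 - y1" "v1 = x3 - x1" "v2 = y3 - y1"
  define p q where pq: "p = o1 - x1" "q = o2 - y1"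
  define \<Delta> where "\<Delta> = u1 * v2 - u2 * v1"
  have "2 * (p * u1 + q * u2) = u1 ^ 2 + u2 ^ 2" "2 * (p * v1 + q * v2) = v1 ^ 2 + v2 ^ 2"
    unfolding uv pq using assms(2)[folded assms(1)] assms(3)[folded assms(1)] by algebra+
  then have e: "2 * \<Delta> * p = v2 * (u1 ^ 2 + u2 ^ 2) - u2 * (v1 ^ 2 + v2 ^ 2)"
    "2 * \<Delta> * q = u1 * (v1 ^ 2 + v2 ^ 2) - v1 * (u1 ^ 2 + u2 ^ 2)"
    unfolding \<Delta>_def by algebra+
  have "4 * \<Delta> ^ 2 * R2 = (2 * \<Delta> * p) ^ 2 + (2 * \<Delta> * q) ^ 2"
    unfolding pq assms(1)[symmetric] by algebra
  also have "\<dots> = ((v1 - u1) ^ 2 + (v2 - u2) ^ 2) * (v1 ^ 2 + v2 ^ 2) * (u1 ^ 2 + u2 ^ 2)"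
    unfolding e by algebra
  finally show ?thesis
    unfolding \<Delta>_def uv power2_commute[of x1 x3] power2_commute[of y1 y3] by simp
qed

text \<open>The center \<open>(n1, n2)\<close> is midway between circumcenter and orthocenter, so it
  projects onto the side line midway between the side's midpoint and the altitude foot. Hence it is
  equidistant from these two points.\<close>

lemma altitude_foot_on_nine_point_circle:
  fixes x1 y1 x2 y2 x3 y3 :: "'a::ordered_pythagorean_field"
  assumes ne: "(x2, y2) \<noteq> (x3, y3)"
    and o: "(x1 - o1) ^ 2 + (y1 - o2) ^ 2 = R2"
      "(x2 - o1) ^ 2 + (y2 - o2) ^ 2 = R2"
      "(x3 - o1) ^ 2 + (y3 - o2) ^ 2 = R2"
    and \<rho>: "4 * \<rho> ^ 2 = R2" "0 \<le> \<rho>"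
    and n: "2 * n1 = x1 + x2 + x3 - o1" "2 * n2 = y1 + y2 + y3 - o2"
  shows "altitude_foot (x1, y1) (x2, y2) (x3, y3) \<in> circle (n1, n2) \<rho>"
proof -
  obtain d1 d2 where d: "altitude_foot (x1, y1) (x2, y2) (x3, y3) = (d1, d2)"
    and 1: "(d1 - x1) * (x3 - x2) + (d2 - y1) * (y3 - y2) = 0"
    and 2: "(d1 - x2) * (y3 - y2) = (d2 - y2) * (x3 - x2)"
    using altitude_foot_coordinates[OF ne] .
  \<comment> \<open>Four times the difference of the squared distances of the center from the foot
    and from the midpoint of the side, factored as an inner product. \<open>par\<close> and
    \<open>perp\<close> say that its two factors are parallel and perpendicular to the side.\<close>
  define e where "e = (2 * d1 - x2 - x3) * (2 * d1 + x2 + x3 - 4 * n1) +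
    (2 * d2 - y2 - y3) * (2 * d2 + y2 + y3 - 4 * n2)"
  have perp: "(x3 - x2) * (2 * d1 + x2 + x3 - 4 * n1) + (y3 - y2) * (2 * d2 + y2 + y3 - 4 * n2) = 0"
    using 1 o(2)[folded o(3)] n by algebra
  have par: "(2 * d1 - x2 - x3) * (y3 - y2) = (2 * d2 - y2 - y3) * (x3 - x2)"
    using 2 by algebra
  have "(x3 - x2) * e = 0" "(y3 - y2) * e = 0"
    using perp par unfolding e_def by algebra+
  then have "e = 0" using ne by auto
  then have "4 * ((n1 - d1) ^ 2 + (n2 - d2) ^ 2) = (2 * n1 - x2 - x3) ^ 2 + (2 * n2 - y2 - y3) ^ 2"
    unfolding e_def by algebra
  also have "\<dots> = 4 * \<rho> ^ 2" unfolding n \<rho>(1) o(1)[symmetric] by algebra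
  finally show ?thesis unfolding d mem_circle[OF \<rho>(2)] by simp
qed

text \<open>Subtracting the equations of one circle at two points leaves a linear equation for its
  center. Applied to the three side midpoints, this makes \<open>nine_point_circle\<close> well
  defined.\<close>

lemma circle_through_three_points_unique:
  fixes r r' :: "'a::ordered_pythagorean_field"
  assumes "0 \<le> r" "0 \<le> r'"
    and "(p1, p2) \<in> circle (z, w) r" "(q1, q2) \<in> circle (z, w) r" "(s1, s2) \<in> circle (z, w) r"
    and "(p1, p2) \<in> circle (z', w') r'" "(q1, q2) \<in> circle (z', w') r'" "(s1, s2) \<in> circle (z', w') r'"
    and nz: "(q1 - p1) * (s2 - p2) - (q2 - p2) * (s1 - p1) \<noteq> 0"
  shows "circle (z, w) r = circle (z', w') r'"
proof -
  note eqs = assms(3-8)[unfolded mem_circle[OF assms(1)] mem_circle[OF assms(2)]]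
  have lin: "2 * (z0 * (t1 - p1) + w0 * (t2 - p2)) = t1 ^ 2 + t2 ^ 2 - p1 ^ 2 - p2 ^ 2"
    if "(z0 - t1) ^ 2 + (w0 - t2) ^ 2 = (z0 - p1) ^ 2 + (w0 - p2) ^ 2" for z0 w0 t1 t2 :: 'a
    using that by algebra
  have "(z - z') * (q1 - p1) + (w - w') * (q2 - p2) = 0"
    using lin[OF eqs(2)[folded eqs(1)]] lin[OF eqs(5)[folded eqs(4)]] by algebra
  moreover have "(z - z') * (s1 - p1) + (w - w') * (s2 - p2) = 0"
    using lin[OF eqs(3)[folded eqs(1)]] lin[OF eqs(6)[folded eqs(4)]] by algebra
  ultimately have "z - z' = 0" "w - w' = 0"
    using orthogonal_to_independent_eq_0[OF _ _ nz] by blast+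
  then have zw: "z = z'" "w = w'" by simp_all
  have "r ^ 2 = r' ^ 2" using eqs(1,4) by (simp add: zw)
  then have "r = r'" using assms(1,2) by (simp add: power2_eq_iff_nonneg)
  then show ?thesis by (simp add: zw)
qed

lemma nine_point_circle_coordinates:
  fixes x1 y1 x2 y2 x3 y3 :: "'a::ordered_pythagorean_field"
  assumes nz: "(x2 - x1) * (y3 - y1) - (y2 - y1) * (x3 - x1) \<noteq> 0"
    and o: "(x1 - o1) ^ 2 + (y1 - o2) ^ 2 = R2"
      "(x2 - o1) ^ 2 + (y2 - o2) ^ 2 = R2"
      "(x3 - o1) ^ 2 + (y3 - o2) ^ 2 = R2"
    and \<rho>: "4 * \<rho> ^ 2 = R2" "0 < \<rho>"
    and n: "2 * n1 = x1 + x2 + x3 - o1" "2 * n2 = y1 + y2 + y3 - o2"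
  shows "nine_point_circle (x1, y1) (x2, y2) (x3, y3) = circle (n1, n2) \<rho>"
proof -
  have ne: "(x2, y2) \<noteq> (x3, y3)" "(x3, y3) \<noteq> (x1, y1)" "(x1, y1) \<noteq> (x2, y2)"
    using nz by (auto simp: algebra_simps)
  have \<rho>0: "0 \<le> \<rho>" using \<rho>(2) by simp
  have n': "n1 = (x1 + x2 + x3 - o1) / 2" "n2 = (y1 + y2 + y3 - o2) / 2"
    using n by auto
  \<comment> \<open>Twice the vector from the center to a side midpoint, or to the midpoint of
    orthocenter and vertex, is up to sign a vector from the circumcenter to a vertex; its squared
    length is \<open>R2\<close>.\<close>
  have half: "((p::'a) / 2) ^ 2 + (q / 2) ^ 2 = \<rho> ^ 2 \<longleftrightarrow> p ^ 2 + q ^ 2 = R2" for p q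
    unfolding \<rho>(1)[symmetric] by (simp add: power_divide field_simps)
  have mids: "midpoint (x2, y2) (x3, y3) \<in> circle (n1, n2) \<rho>"
    "midpoint (x3, y3) (x1, y1) \<in> circle (n1, n2) \<rho>"
    "midpoint (x1, y1) (x2, y2) \<in> circle (n1, n2) \<rho>"
    unfolding midpoint_def fst_conv snd_conv mem_circle[OF \<rho>0] n' diff_divide_distrib[symmetric] half
    using o by (simp_all add: algebra_simps power2_commute)
  have oh: "midpoint (orthocenter (x1, y1) (x2, y2) (x3, y3)) (x1, y1) \<in> circle (n1, n2) \<rho>"
    "midpoint (orthocenter (x1, y1) (x2, y2) (x3, y3)) (x2, y2) \<in> circle (n1, n2) \<rho>"
    "midpoint (orthocenter (x1, y1) (x2, y2) (x3, y3)) (x3, y3) \<in> circle (n1, n2) \<rho>"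
    unfolding orthocenter_coordinates[OF nz o] midpoint_def fst_conv snd_conv mem_circle[OF \<rho>0]
      n' diff_divide_distrib[symmetric] half
    using o by (simp_all add: algebra_simps power2_commute)
  have feet: "altitude_foot (x1, y1) (x2, y2) (x3, y3) \<in> circle (n1, n2) \<rho>"
    "altitude_foot (x2, y2) (x3, y3) (x1, y1) \<in> circle (n1, n2) \<rho>"
    "altitude_foot (x3, y3) (x1, y1) (x2, y2) \<in> circle (n1, n2) \<rho>"
    by (rule altitude_foot_on_nine_point_circle[OF _ _ _ _ \<rho>(1) \<rho>0];
        use ne o n in \<open>simp add: algebra_simps\<close>)+
  show ?thesis unfolding nine_point_circle_def
  proof (rule the_equality, intro conjI mids oh feet)
    show "is_circle (circle (n1, n2) \<rho>)" unfolding is_circle_def using \<rho>(2) by blast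
  next
    fix \<gamma> assume g: "is_circle \<gamma> \<and>
        midpoint (x2, y2) (x3, y3) \<in> \<gamma> \<and> midpoint (x3, y3) (x1, y1) \<in> \<gamma> \<and>
        midpoint (x1, y1) (x2, y2) \<in> \<gamma> \<and>
        altitude_foot (x1, y1) (x2, y2) (x3, y3) \<in> \<gamma> \<and>
        altitude_foot (x2, y2) (x3, y3) (x1, y1) \<in> \<gamma> \<and>
        altitude_foot (x3, y3) (x1, y1) (x2, y2) \<in> \<gamma> \<and>
        midpoint (orthocenter (x1, y1) (x2, y2) (x3, y3)) (x1, y1) \<in> \<gamma> \<and>
        midpoint (orthocenter (x1, y1) (x2, y2) (x3, y3)) (x2, y2) \<in> \<gamma> \<and>
        midpoint (orthocenter (x1, y1) (x2, y2) (x3, y3)) (x3, y3) \<in> \<gamma>"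
    then obtain z w r where r: "0 < r" and \<gamma>: "\<gamma> = circle (z, w) r"
      unfolding is_circle_def by (metis surj_pair)
    note m = g[unfolded \<gamma> midpoint_def fst_conv snd_conv] mids[unfolded midpoint_def fst_conv snd_conv]
    \<comment> \<open>The medial triangle has a quarter of the area, so the three midpoints are not
      collinear.\<close>
    have "4 * (((x3 + x1) / 2 - (x2 + x3) / 2) * ((y1 + y2) / 2 - (y2 + y3) / 2) -
       ((y3 + y1) / 2 - (y2 + y3) / 2) * ((x1 + x2) / 2 - (x2 + x3) / 2)) =
       (x2 - x1) * (y3 - y1) - (y2 - y1) * (x3 - x1)"
      by (simp add: field_simps)
    then have "((x3 + x1) / 2 - (x2 + x3) / 2) * ((y1 + y2) / 2 - (y2 + y3) / 2) -
       ((y3 + y1) / 2 - (y2 + y3) / 2) * ((x1 + x2) / 2 - (x2 + x3) / 2) \<noteq> 0"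
      using nz by auto
    from circle_through_three_points_unique[OF _ \<rho>0 _ _ _ _ _ _ this] m r
    show "\<gamma> = circle (n1, n2) \<rho>" unfolding \<gamma> by simp
  qed
qed

text \<open>Rotating the vertices merely permutes the conjuncts of the descriptions. One excircle
  result thereby serves all three vertices.\<close>

lemma nine_point_circle_rotate: "nine_point_circle B C A = nine_point_circle A B C"
proof -
  have "orthocenter B C A = orthocenter A B C"
    unfolding orthocenter_def by (rule arg_cong[where f = The]) blast
  then show ?thesis
    unfolding nine_point_circle_def by (intro arg_cong[where f = The]) auto
qed

section \<open>The four circles tangent to the side lines\<close>

text \<open>Only the squares of \<open>a\<close>, \<open>b\<close>, \<open>c\<close> are prescribed,
  so the formula also applies to signed lengths.\<close>

lemma heron:
  fixes x1 y1 x2 y2 x3 y3 :: "'a::linordered_field"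
  assumes "a ^ 2 = (x3 - x2) ^ 2 + (y3 - y2) ^ 2"
    and "b ^ 2 = (x1 - x3) ^ 2 + (y1 - y3) ^ 2"
    and "c ^ 2 = (x2 - x1) ^ 2 + (y2 - y1) ^ 2"
  shows "(a + b + c) * (- a + b + c) * (a - b + c) * (a + b - c) =
    4 * ((x2 - x1) * (y3 - y1) - (y2 - y1) * (x3 - x1)) ^ 2"
proof -
  have "(a + b + c) * (- a + b + c) * (a - b + c) * (a + b - c) =
    4 * b ^ 2 * c ^ 2 - (b ^ 2 + c ^ 2 - a ^ 2) ^ 2"
    by algebra
  also have "\<dots> = 4 * ((x2 - x1) * (y3 - y1) - (y2 - y1) * (x3 - x1)) ^ 2"
    unfolding assms by algebra
  finally show ?thesis .
qed

text \<open>The last three factors have positive pairwise sums, so at most one is not positive; a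
  positive product excludes that as well.\<close>

lemma triangle_inequalities:
  fixes a b c :: "'a::linordered_field"
  assumes "0 < a" "0 < b" "0 < c" "0 < (a + b + c) * (- a + b + c) * (a - b + c) * (a + b - c)"
  shows "a < b + c" "b < c + a" "c < a + b"
proof -
  define x y z where "x = - a + b + c" and "y = a - b + c" and "z = a + b - c"
  have "0 < (a + b + c) * (x * y * z)" using assms(4) by (simp add: x_def y_def z_def mult.assoc)
  moreover have "0 < a + b + c" using assms(1-3) by simp
  ultimately have xyz: "0 < x * y * z" using zero_less_mult_pos by blast
  have sums: "0 < x + y" "0 < y + z" "0 < z + x"
    using assms(1-3) by (simp_all add: x_def y_def z_def)
  have "0 < x \<and> 0 < y \<and> 0 < z"
    using xyz sums by (auto simp: zero_less_mult_iff mult_less_0_iff)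
  then show "a < b + c" "b < c + a" "c < a + b" by (auto simp: x_def y_def z_def)
qed

text \<open>The equality case of Euler's inequality between circumradius and twice the inradius. In
  the factors \<open>x\<close>, \<open>y\<close>, \<open>z\<close> the hypothesis reads
  \<open>(x + y) * (y + z) * (z + x) = 8 * x * y * z\<close>, and the difference of the two sides is
  a sum of squares with positive weights.\<close>

lemma equal_sides_if_product:
  fixes a b c :: "'a::linordered_field"
  assumes "a < b + c" "b < c + a" "c < a + b"
    and "a * b * c = (- a + b + c) * (a - b + c) * (a + b - c)"
  shows "a = b" "b = c"
proof -
  define x y z where xyz: "x = - a + b + c" "y = a - b + c" "z = a + b - c"
  have pos: "0 < x" "0 < y" "0 < z" using assms(1-3) by (simp_all add: xyz)
  have "x * (y - z) ^ 2 + y * (z - x) ^ 2 + z * (x - y) ^ 2 = 0"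
    using assms(4) unfolding xyz by algebra
  moreover have "0 \<le> x * (y - z) ^ 2" "0 \<le> y * (z - x) ^ 2" "0 \<le> z * (x - y) ^ 2"
    using pos by simp_all
  ultimately have "x * (y - z) ^ 2 = 0" "z * (x - y) ^ 2 = 0" by linarith+
  then have "y = z" "x = y" using pos by auto
  then show "a = b" "b = c" by (auto simp: xyz)
qed

section \<open>Distance from the nine-point center to a tritangent center\<close>

lemma nine_point_center_distance:
  fixes x1 y1 x2 y2 x3 y3 :: "'a::linordered_field"
  assumes o: "(x1 - o1) ^ 2 + (y1 - o2) ^ 2 = R2"
      "(x2 - o1) ^ 2 + (y2 - o2) ^ 2 = R2"
      "(x3 - o1) ^ 2 + (y3 - o2) ^ 2 = R2"
    and n: "2 * n1 = x1 + x2 + x3 - o1" "2 * n2 = y1 + y2 + y3 - o2"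
    and len: "a ^ 2 = (x3 - x2) ^ 2 + (y3 - y2) ^ 2"
      "b ^ 2 = (x1 - x3) ^ 2 + (y1 - y3) ^ 2"
      "c ^ 2 = (x2 - x1) ^ 2 + (y2 - y1) ^ 2"
    and \<Delta>: "\<Delta> = (x2 - x1) * (y3 - y1) - (y2 - y1) * (x3 - x1)" "\<Delta> \<noteq> 0"
    and s: "s = a + b + c" "s \<noteq> 0"
    and i: "i1 * s = a * x1 + b * x2 + c * x3" "i2 * s = a * y1 + b * y2 + c * y3"
  shows "(n1 - i1) ^ 2 + (n2 - i2) ^ 2 = (a * b * c / (4 * \<Delta>) - \<Delta> / s) ^ 2"
proof -
  define \<rho> \<sigma> where "\<rho> = a * b * c / (4 * \<Delta>)" and "\<sigma> = \<Delta> / s"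
  have \<rho>: "4 * \<rho> * \<Delta> = a * b * c" and \<sigma>: "\<sigma> * s = \<Delta>"
    using \<Delta>(2) s(2) by (simp_all add: \<rho>_def \<sigma>_def)
  have "4 * \<Delta> ^ 2 * R2 = 4 * \<Delta> ^ 2 * (4 * \<rho> ^ 2)"
  proof -
    have "4 * \<Delta> ^ 2 * R2 = a ^ 2 * b ^ 2 * c ^ 2"
      using circumradius_squared[OF o] unfolding len \<Delta>(1) .
    also have "\<dots> = (4 * \<rho> * \<Delta>) ^ 2" unfolding \<rho> by algebra
    finally show ?thesis by algebra
  qed
  then have R2: "R2 = 4 * \<rho> ^ 2" using \<Delta>(2) by simp
  define p1 p2 q1 q2 t1 t2 where pq: "p1 = x1 - o1" "p2 = y1 - o2" "q1 = x2 - o1" "q2 = y2 - o2"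
    "t1 = x3 - o1" "t2 = y3 - o2"
  have sq: "p1 ^ 2 + p2 ^ 2 = R2" "q1 ^ 2 + q2 ^ 2 = R2" "t1 ^ 2 + t2 ^ 2 = R2"
    using o by (simp_all add: pq)
  have "c ^ 2 = (q1 ^ 2 + q2 ^ 2) + (p1 ^ 2 + p2 ^ 2) - 2 * (p1 * q1 + p2 * q2)"
    "a ^ 2 = (t1 ^ 2 + t2 ^ 2) + (q1 ^ 2 + q2 ^ 2) - 2 * (q1 * t1 + q2 * t2)"
    "b ^ 2 = (p1 ^ 2 + p2 ^ 2) + (t1 ^ 2 + t2 ^ 2) - 2 * (t1 * p1 + t2 * p2)"
    unfolding len pq by algebra+
  then have dot: "2 * (p1 * q1 + p2 * q2) = 2 * R2 - c ^ 2" "2 * (q1 * t1 + q2 * t2) = 2 * R2 - a ^ 2"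
    "2 * (t1 * p1 + t2 * p2) = 2 * R2 - b ^ 2"
    unfolding sq by simp_all
  \<comment> \<open>The weights with which the vectors from the circumcenter to the vertices combine
    to \<open>2 * s\<close> times the vector between the centers.\<close>
  define \<alpha> \<beta> \<gamma> where w: "\<alpha> = s - 2 * a" "\<beta> = s - 2 * b" "\<gamma> = s - 2 * c"
  have c1: "2 * s * (n1 - i1) = \<alpha> * p1 + \<beta> * q1 + \<gamma> * t1"
    using n(1) i(1) s(1) unfolding w pq by algebra
  have c2: "2 * s * (n2 - i2) = \<alpha> * p2 + \<beta> * q2 + \<gamma> * t2"
    using n(2) i(2) s(1) unfolding w pq by algebra
  have "4 * s ^ 2 * ((n1 - i1) ^ 2 + (n2 - i2) ^ 2) =
    (2 * s * (n1 - i1)) ^ 2 + (2 * s * (n2 - i2)) ^ 2" by algebra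
  also have "\<dots> = \<alpha> ^ 2 * (p1 ^ 2 + p2 ^ 2) + \<beta> ^ 2 * (q1 ^ 2 + q2 ^ 2) + \<gamma> ^ 2 * (t1 ^ 2 + t2 ^ 2)
    + \<alpha> * \<beta> * (2 * (p1 * q1 + p2 * q2)) + \<beta> * \<gamma> * (2 * (q1 * t1 + q2 * t2))
    + \<gamma> * \<alpha> * (2 * (t1 * p1 + t2 * p2))"
    unfolding c1 c2 by algebra
  \<comment> \<open>The weights add up to \<open>s\<close>, so the terms with \<open>R2\<close>
    collect to \<open>s ^ 2 * R2\<close>.\<close>
  also have "\<dots> = s ^ 2 * R2 - (\<alpha> * \<beta> * c ^ 2 + \<beta> * \<gamma> * a ^ 2 + \<gamma> * \<alpha> * b ^ 2)"
    unfolding sq dot w s(1) by algebra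
  also have "\<alpha> * \<beta> * c ^ 2 + \<beta> * \<gamma> * a ^ 2 + \<gamma> * \<alpha> * b ^ 2 =
    2 * (a * b * c) * s - (a + b + c) * (- a + b + c) * (a - b + c) * (a + b - c)"
    unfolding w s(1) by algebra
  also have "(a + b + c) * (- a + b + c) * (a - b + c) * (a + b - c) = 4 * \<Delta> ^ 2"
    using heron[OF len] unfolding \<Delta>(1) .
  \<comment> \<open>Substituting \<open>R2 = 4 * \<rho> ^ 2\<close>,
    \<open>a * b * c = 4 * \<rho> * \<Delta>\<close> and \<open>\<Delta> = \<sigma> * s\<close>
    leaves a perfect square.\<close>
  also have "s ^ 2 * R2 - (2 * (a * b * c) * s - 4 * \<Delta> ^ 2) = 4 * s ^ 2 * (\<rho> - \<sigma>) ^ 2"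
    unfolding R2 \<rho>[symmetric] \<sigma>[symmetric] by algebra
  finally show ?thesis using s(2) unfolding \<rho>_def \<sigma>_def by simp
qed

section \<open>Contact points and uniqueness of tritangent circles\<close>

text \<open>\<open>d * a\<close> is the signed tangent length from \<open>(x2, y2)\<close>. The
  choice of \<open>d\<close> makes the vector from the contact point to the center perpendicular to
  the side; its cross product with the side then gives its length.\<close>

lemma tangent_at_contact_point:
  fixes x1 y1 x2 y2 x3 y3 :: "'a::ordered_pythagorean_field"
  assumes len: "a ^ 2 = (x3 - x2) ^ 2 + (y3 - y2) ^ 2"
      "b ^ 2 = (x1 - x3) ^ 2 + (y1 - y3) ^ 2"
      "c ^ 2 = (x2 - x1) ^ 2 + (y2 - y1) ^ 2"
    and \<Delta>: "\<Delta> = (x2 - x1) * (y3 - y1) - (y2 - y1) * (x3 - x1)" "\<Delta> \<noteq> 0"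
    and s: "s = a + b + c" "s \<noteq> 0"
    and i: "i1 * s = a * x1 + b * x2 + c * x3" "i2 * s = a * y1 + b * y2 + c * y3"
    and d: "2 * (d * a) = a + c - b"
  shows "tangent_line_at (line (x2, y2) (x3, y3)) (circle (i1, i2) \<bar>\<Delta> / s\<bar>)
    (x2 + d * (x3 - x2), y2 + d * (y3 - y2))"
proof -
  have ne: "(x2, y2) \<noteq> (x3, y3)" using \<Delta> by (auto simp: algebra_simps)
  then have a: "a \<noteq> 0" using len(1) by (auto simp: sum_power2_eq_zero_iff)
  define m n where mn: "m = x3 - x2" "n = y3 - y2"
  define p q where pq: "p = i1 - (x2 + d * m)" "q = i2 - (y2 + d * n)"
  have sp: "s * p = a * (x1 - x2) + c * m - d * s * m" "s * q = a * (y1 - y2) + c * n - d * s * n"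
    using i unfolding pq mn s(1) by algebra+
  have a2: "m ^ 2 + n ^ 2 = a ^ 2" using len(1) by (simp add: mn)
  have dot: "2 * ((x1 - x2) * m + (y1 - y2) * n) = a ^ 2 + c ^ 2 - b ^ 2"
    unfolding len mn by algebra
  have "2 * (s * (p * m + q * n)) = 2 * ((s * p) * m + (s * q) * n)" by algebra
  also have "\<dots> = a * (2 * ((x1 - x2) * m + (y1 - y2) * n)) + 2 * (c - d * s) * (m ^ 2 + n ^ 2)"
    unfolding sp by algebra
  also have "\<dots> = a * (a ^ 2 + c ^ 2 - b ^ 2 + 2 * c * a - s * (2 * (d * a)))"
    unfolding a2 dot by algebra
  also have "\<dots> = 0" unfolding d s(1) by algebra
  finally have perp: "p * m + q * n = 0" using s(2) by simp
  have "s * (q * m - p * n) = (s * q) * m - (s * p) * n" by algebra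
  also have "\<dots> = a * \<Delta>" unfolding sp \<Delta>(1) mn by algebra
  finally have cross: "s * (q * m - p * n) = a * \<Delta>" .
  \<comment> \<open>Lagrange's identity: the product of two squared lengths is the squared cross
    product plus the squared inner product.\<close>
  have "s ^ 2 * a ^ 2 * (p ^ 2 + q ^ 2) = (s * (q * m - p * n)) ^ 2 + (s * (p * m + q * n)) ^ 2"
    unfolding a2[symmetric] by algebra
  also have "\<dots> = s ^ 2 * a ^ 2 * (\<Delta> / s) ^ 2"
    unfolding cross perp using s(2) by (simp add: power_mult_distrib power_divide)
  finally have "p ^ 2 + q ^ 2 = (\<Delta> / s) ^ 2" using a s(2) by simp
  then show ?thesis
    unfolding tangent_line_at_circle_iff[OF ne abs_ge_zero] power2_abs mn[symmetric] pq[symmetric]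
    using perp by (simp add: mult.assoc mult.commute[of m n])
qed

text \<open>Pythagoras with the right angle at the contact point. Comparing two sides at a common
  vertex shows that the tangent segments from it agree up to sign.\<close>

lemma squared_tangent_lengths:
  fixes r :: "'a::ordered_pythagorean_field"
  assumes "tangent_line_at (line (p1, p2) (q1, q2)) (circle (z, w) r)
      (p1 + t * (q1 - p1), p2 + t * (q2 - p2))"
    and "(p1, p2) \<noteq> (q1, q2)" "0 \<le> r" "l ^ 2 = (q1 - p1) ^ 2 + (q2 - p2) ^ 2"
  shows "(z - p1) ^ 2 + (w - p2) ^ 2 = r ^ 2 + (t * l) ^ 2"
    and "(z - q1) ^ 2 + (w - q2) ^ 2 = r ^ 2 + ((1 - t) * l) ^ 2"
proof -
  define m n where mn: "m = q1 - p1" "n = q2 - p2"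
  have q: "q1 = p1 + m" "q2 = p2 + n" by (simp_all add: mn)
  define g h where gh: "g = z - (p1 + t * m)" "h = w - (p2 + t * n)"
  have zw: "z = g + (p1 + t * m)" "w = h + (p2 + t * n)" by (simp_all add: gh)
  have r: "g ^ 2 + h ^ 2 = r ^ 2" and perp: "g * m + h * n = 0"
    using assms(1) unfolding tangent_line_at_circle_iff[OF assms(2,3)] by (simp_all add: gh mn)
  have l: "l ^ 2 = m ^ 2 + n ^ 2" using assms(4) by (simp add: mn)
  have "(z - p1) ^ 2 + (w - p2) ^ 2 = g ^ 2 + h ^ 2 + 2 * t * (g * m + h * n) + t ^ 2 * (m ^ 2 + n ^ 2)"
    unfolding zw by algebra
  then show "(z - p1) ^ 2 + (w - p2) ^ 2 = r ^ 2 + (t * l) ^ 2"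
    unfolding r perp l[symmetric] by (simp add: power_mult_distrib)
  have "(z - q1) ^ 2 + (w - q2) ^ 2 =
    g ^ 2 + h ^ 2 - 2 * (1 - t) * (g * m + h * n) + (1 - t) ^ 2 * (m ^ 2 + n ^ 2)"
    unfolding zw q by algebra
  then show "(z - q1) ^ 2 + (w - q2) ^ 2 = r ^ 2 + ((1 - t) * l) ^ 2"
    unfolding r perp l[symmetric] by (simp add: power_mult_distrib)
qed

lemma eq_if_power2_eq_same_sign:
  fixes x y :: "'a::linordered_field"
  assumes "x ^ 2 = y ^ 2" "0 \<le> x * y"
  shows "x = y"
proof (rule ccontr)
  assume "x \<noteq> y"
  then have "x = - y" using assms(1) by (simp add: power2_eq_iff)
  then show False using assms(2) \<open>x \<noteq> y\<close> by (auto simp: mult_le_0_iff)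
qed

text \<open>
  The three sign conditions say that the two tangent segments from each vertex have the same
  length also when the lengths are taken with signs.
\<close>

lemma tritangent_circle_unique:
  fixes x1 y1 x2 y2 x3 y3 :: "'a::ordered_pythagorean_field"
  assumes len: "a ^ 2 = (x3 - x2) ^ 2 + (y3 - y2) ^ 2"
      "b ^ 2 = (x1 - x3) ^ 2 + (y1 - y3) ^ 2"
      "c ^ 2 = (x2 - x1) ^ 2 + (y2 - y1) ^ 2"
    and \<Delta>: "\<Delta> = (x2 - x1) * (y3 - y1) - (y2 - y1) * (x3 - x1)" "\<Delta> \<noteq> 0"
    and s: "s = a + b + c" "s \<noteq> 0"
    and i: "i1 * s = a * x1 + b * x2 + c * x3" "i2 * s = a * y1 + b * y2 + c * y3"
    and r: "0 \<le> r"
    and T: "tangent_line_at (line (x2, y2) (x3, y3)) (circle (z, w) r)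
        (x2 + d * (x3 - x2), y2 + d * (y3 - y2))"
      "tangent_line_at (line (x3, y3) (x1, y1)) (circle (z, w) r)
        (x3 + e * (x1 - x3), y3 + e * (y1 - y3))"
      "tangent_line_at (line (x1, y1) (x2, y2)) (circle (z, w) r)
        (x1 + f * (x2 - x1), y1 + f * (y2 - y1))"
    and signs: "0 \<le> ((1 - e) * b) * (f * c)" "0 \<le> ((1 - f) * c) * (d * a)"
      "0 \<le> ((1 - d) * a) * (e * b)"
  shows "circle (z, w) r = circle (i1, i2) \<bar>\<Delta> / s\<bar>"
proof -
  have ne: "(x2, y2) \<noteq> (x3, y3)" "(x3, y3) \<noteq> (x1, y1)" "(x1, y1) \<noteq> (x2, y2)"
    using \<Delta> by (auto simp: algebra_simps)
  note L = squared_tangent_lengths[OF T(1) ne(1) r len(1)]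
    squared_tangent_lengths[OF T(2) ne(2) r len(2)]
    squared_tangent_lengths[OF T(3) ne(3) r len(3)]
  have "((1 - e) * b) ^ 2 = (f * c) ^ 2" "((1 - f) * c) ^ 2 = (d * a) ^ 2"
    "((1 - d) * a) ^ 2 = (e * b) ^ 2"
    using L by simp_all
  then have "(1 - e) * b = f * c" "(1 - f) * c = d * a" "(1 - d) * a = e * b"
    using signs eq_if_power2_eq_same_sign by blast+
  \<comment> \<open>The three equalities of signed tangent segments form a linear system that fixes
    the contact points.\<close>
  then have de: "2 * (d * a) = a + c - b" "2 * (e * b) = b + a - c"
    by algebra+
  have U1: "tangent_line_at (line (x2, y2) (x3, y3)) (circle (i1, i2) \<bar>\<Delta> / s\<bar>)
    (x2 + d * (x3 - x2), y2 + d * (y3 - y2))"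
    by (rule tangent_at_contact_point[OF len \<Delta> s i de(1)])
  have U2: "tangent_line_at (line (x3, y3) (x1, y1)) (circle (i1, i2) \<bar>\<Delta> / s\<bar>)
    (x3 + e * (x1 - x3), y3 + e * (y1 - y3))"
  proof (rule tangent_at_contact_point[OF len(2,3,1) _ \<Delta>(2) _ s(2) _ _ de(2)])
    show "\<Delta> = (x3 - x2) * (y1 - y2) - (y3 - y2) * (x1 - x2)" unfolding \<Delta>(1) by algebra
  qed (simp_all add: s(1)[symmetric] i, simp_all add: s(1))
  note t = T(1)[unfolded tangent_line_at_circle_iff[OF ne(1) r]]
    T(2)[unfolded tangent_line_at_circle_iff[OF ne(2) r]]
  note u = U1[unfolded tangent_line_at_circle_iff[OF ne(1) abs_ge_zero]]
    U2[unfolded tangent_line_at_circle_iff[OF ne(2) abs_ge_zero]]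
  \<comment> \<open>Both centers lie on the normals to two sides at the same contact points, and
    these normals meet only once.\<close>
  have "(z - i1) * (x3 - x2) + (w - i2) * (y3 - y2) = 0"
    using t(1) u(1) by (simp add: algebra_simps)
  moreover have "(z - i1) * (x1 - x3) + (w - i2) * (y1 - y3) = 0"
    using t(2) u(2) by (simp add: algebra_simps)
  moreover have "(x3 - x2) * (y1 - y3) - (y3 - y2) * (x1 - x3) \<noteq> 0"
  proof -
    have "(x3 - x2) * (y1 - y3) - (y3 - y2) * (x1 - x3) = \<Delta>" unfolding \<Delta>(1) by algebra
    then show ?thesis using \<Delta>(2) by simp
  qed
  ultimately have "z - i1 = 0" "w - i2 = 0"
    using orthogonal_to_independent_eq_0 by blast+
  then have zw: "z = i1" "w = i2" by simp_all
  have "r ^ 2 = \<bar>\<Delta> / s\<bar> ^ 2" using t(1) u(1) unfolding zw by metis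
  then have "r = \<bar>\<Delta> / s\<bar>" using r power2_eq_imp_eq abs_ge_zero by blast
  then show ?thesis by (simp add: zw)
qed

section \<open>Identification of the incircle and the excircle\<close>

lemma between_coordinates:
  "between (p1, p2) X (q1, q2) \<longleftrightarrow> (p1, p2) \<noteq> (q1, q2) \<and>
    (\<exists>t. 0 < t \<and> t < 1 \<and> X = (p1 + t * (q1 - p1), p2 + t * (q2 - p2)))"
  unfolding between_def by (cases X) auto

text \<open>Here the unknown point is an endpoint, so the parameter in \<open>between\<close> is
  inverted: \<open>k\<close> is \<open>1 / t\<close>. Contacts on extended sides thus get the same
  parametrization as contacts on sides.\<close>

lemma between_beyond:
  fixes p1 p2 q1 q2 :: "'a::linordered_field"
  shows "between (p1, p2) (q1, q2) X \<longleftrightarrow> (p1, p2) \<noteq> (q1, q2) \<and>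
    (\<exists>k. 1 < k \<and> X = (p1 + k * (q1 - p1), p2 + k * (q2 - p2)))" (is "?L \<longleftrightarrow> ?R")
proof -
  obtain g h where X: "X = (g, h)" by fastforce
  show ?thesis
  proof
    assume ?L
    then obtain t where t: "0 < t" "t < 1" "q1 = p1 + t * (g - p1)" "q2 = p2 + t * (h - p2)"
      and ne: "(p1, p2) \<noteq> (g, h)"
      unfolding X between_def by auto
    have "g = p1 + 1 / t * (q1 - p1)" "h = p2 + 1 / t * (q2 - p2)" "1 < 1 / t"
      using t(1,2) unfolding t(3,4) by simp_all
    moreover have "(p1, p2) \<noteq> (q1, q2)" using ne t(1) unfolding t(3,4) by auto
    ultimately show ?R unfolding X by blast
  next
    assume ?R
    then obtain k where k: "1 < k" "g = p1 + k * (q1 - p1)" "h = p2 + k * (q2 - p2)"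
      and ne: "(p1, p2) \<noteq> (q1, q2)"
      unfolding X by auto
    have "0 < k" using k(1) by simp
    then have "0 < 1 / k" "1 / k < 1" "q1 = p1 + 1 / k * (g - p1)" "q2 = p2 + 1 / k * (h - p2)"
      using k(1) unfolding k(2,3) by simp_all
    moreover have "(p1, p2) \<noteq> (g, h)" using ne \<open>0 < k\<close> unfolding k(2,3) by auto
    ultimately show ?L unfolding X between_def fst_conv snd_conv by blast
  qed
qed

lemma incircle_coordinates:
  fixes x1 y1 x2 y2 x3 y3 :: "'a::ordered_pythagorean_field"
  assumes len: "a ^ 2 = (x3 - x2) ^ 2 + (y3 - y2) ^ 2"
      "b ^ 2 = (x1 - x3) ^ 2 + (y1 - y3) ^ 2"
      "c ^ 2 = (x2 - x1) ^ 2 + (y2 - y1) ^ 2"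
    and pos: "0 < a" "0 < b" "0 < c" "a < b + c" "b < c + a" "c < a + b"
    and \<Delta>: "\<Delta> = (x2 - x1) * (y3 - y1) - (y2 - y1) * (x3 - x1)" "\<Delta> \<noteq> 0"
    and s: "s = a + b + c"
    and i: "i1 * s = a * x1 + b * x2 + c * x3" "i2 * s = a * y1 + b * y2 + c * y3"
  shows "incircle (x1, y1) (x2, y2) (x3, y3) = circle (i1, i2) \<bar>\<Delta> / s\<bar>"
proof -
  have ne: "(x2, y2) \<noteq> (x3, y3)" "(x3, y3) \<noteq> (x1, y1)" "(x1, y1) \<noteq> (x2, y2)"
    using \<Delta> by (auto simp: algebra_simps)
  have s0: "0 < s" "s \<noteq> 0" using pos s by simp_all
  \<comment> \<open>Tangent lengths divided by side lengths; the triangle inequalities place these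
    parameters strictly between \<open>0\<close> and \<open>1\<close>.\<close>
  define d e f where def: "d = (a + c - b) / (2 * a)" "e = (b + a - c) / (2 * b)"
    "f = (c + b - a) / (2 * c)"
  have defs: "2 * (d * a) = a + c - b" "2 * (e * b) = b + a - c" "2 * (f * c) = c + b - a"
    using pos by (simp_all add: def)
  have rng: "0 < d" "d < 1" "0 < e" "e < 1" "0 < f" "f < 1"
    using pos by (simp_all add: def field_simps)
  have T1: "tangent_line_at (line (x2, y2) (x3, y3)) (circle (i1, i2) \<bar>\<Delta> / s\<bar>)
    (x2 + d * (x3 - x2), y2 + d * (y3 - y2))"
    by (rule tangent_at_contact_point[OF len \<Delta> s s0(2) i defs(1)])
  have \<Delta>': "\<Delta> = (x3 - x2) * (y1 - y2) - (y3 - y2) * (x1 - x2)"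
    "\<Delta> = (x1 - x3) * (y2 - y3) - (y1 - y3) * (x2 - x3)"
    unfolding \<Delta>(1) by algebra+
  have T2: "tangent_line_at (line (x3, y3) (x1, y1)) (circle (i1, i2) \<bar>\<Delta> / s\<bar>)
    (x3 + e * (x1 - x3), y3 + e * (y1 - y3))"
    by (rule tangent_at_contact_point[OF len(2,3,1) \<Delta>'(1) \<Delta>(2) _ s0(2) _ _ defs(2)])
      (simp_all add: i, simp_all add: s)
  have T3: "tangent_line_at (line (x1, y1) (x2, y2)) (circle (i1, i2) \<bar>\<Delta> / s\<bar>)
    (x1 + f * (x2 - x1), y1 + f * (y2 - y1))"
    by (rule tangent_at_contact_point[OF len(3,1,2) \<Delta>'(2) \<Delta>(2) _ s0(2) _ _ defs(3)])
      (simp_all add: i, simp_all add: s)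
  have "inside_triangle (i1, i2) (x1, y1) (x2, y2) (x3, y3)"
    unfolding inside_triangle_def
  proof (intro exI conjI)
    \<comment> \<open>\<open>(g, h)\<close> is the foot of the angle bisector from the first vertex,
      dividing the opposite side in the ratio \<open>c\<close> to \<open>b\<close>; the incenter
      lies on that bisector at parameter \<open>(b + c) / s\<close>.\<close>
    define t where "t = c / (b + c)"
    define g h where gh: "g = x2 + t * (x3 - x2)" "h = y2 + t * (y3 - y2)"
    have bc: "0 < b + c" using pos by simp
    show "between (x2, y2) (g, h) (x3, y3)"
      unfolding between_coordinates gh using ne(1) pos bc
      by (intro conjI exI[of _ t]) (simp_all add: t_def)
    have g: "g * (b + c) = b * x2 + c * x3" "h * (b + c) = b * y2 + c * y3"
      using bc by (simp_all add: gh t_def field_simps)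
    define k where "k = (b + c) / s"
    have k: "k * s = b + c" using s0(2) by (simp add: k_def)
    have "i1 * s = (x1 + k * (g - x1)) * s" "i2 * s = (y1 + k * (h - y1)) * s"
      unfolding i using k g s by algebra+
    then have e: "i1 = x1 + k * (g - x1)" "i2 = y1 + k * (h - y1)"
      using s0(2) by simp_all
    have "(x1, y1) \<noteq> (g, h)"
    proof
      assume "(x1, y1) = (g, h)"
      then have e: "x1 = x2 + t * (x3 - x2)" "y1 = y2 + t * (y3 - y2)" by (simp_all add: gh)
      have "\<Delta> = 0" unfolding \<Delta>(1) e by algebra
      then show False using \<Delta>(2) by simp
    qed
    then show "between (x1, y1) (i1, i2) (g, h)"
      unfolding between_coordinates using pos s0 e
      by (intro conjI exI[of _ k]) (auto simp: k_def s)
  qed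
  moreover have "0 < \<bar>\<Delta> / s\<bar>" using \<Delta>(2) s0 by simp
  ultimately have ex: "\<exists>Z r. 0 < r \<and> circle (i1, i2) \<bar>\<Delta> / s\<bar> = circle Z r \<and>
    inside_triangle Z (x1, y1) (x2, y2) (x3, y3)" by blast
  have B: "between (x2, y2) (x2 + d * (x3 - x2), y2 + d * (y3 - y2)) (x3, y3)"
    "between (x3, y3) (x3 + e * (x1 - x3), y3 + e * (y1 - y3)) (x1, y1)"
    "between (x1, y1) (x1 + f * (x2 - x1), y1 + f * (y2 - y1)) (x2, y2)"
    unfolding between_coordinates using ne rng by blast+
  show ?thesis unfolding incircle_def
  proof (rule the_equality)
    fix \<gamma> assume g: "(\<exists>Z r. 0 < r \<and> \<gamma> = circle Z r \<and> inside_triangle Z (x1, y1) (x2, y2) (x3, y3)) \<and>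
      (\<exists>D. between (x2, y2) D (x3, y3) \<and> tangent_line_at (line (x2, y2) (x3, y3)) \<gamma> D) \<and>
      (\<exists>E. between (x3, y3) E (x1, y1) \<and> tangent_line_at (line (x3, y3) (x1, y1)) \<gamma> E) \<and>
      (\<exists>F. between (x1, y1) F (x2, y2) \<and> tangent_line_at (line (x1, y1) (x2, y2)) \<gamma> F)"
    then obtain z w r where r: "0 < r" and \<gamma>: "\<gamma> = circle (z, w) r"
      by (metis surj_pair)
    from g obtain d' e' f' where t: "0 < d'" "d' < 1" "0 < e'" "e' < 1" "0 < f'" "f' < 1"
      and T: "tangent_line_at (line (x2, y2) (x3, y3)) \<gamma> (x2 + d' * (x3 - x2), y2 + d' * (y3 - y2))"
      "tangent_line_at (line (x3, y3) (x1, y1)) \<gamma> (x3 + e' * (x1 - x3), y3 + e' * (y1 - y3))"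
      "tangent_line_at (line (x1, y1) (x2, y2)) \<gamma> (x1 + f' * (x2 - x1), y1 + f' * (y2 - y1))"
      unfolding between_coordinates by auto
    show "\<gamma> = circle (i1, i2) \<bar>\<Delta> / s\<bar>"
      unfolding \<gamma>
      by (rule tritangent_circle_unique[OF len \<Delta> s s0(2) i _ T[unfolded \<gamma>]])
        (use r t pos in simp_all)
  qed (use ex T1 T2 T3 B in blast)
qed

text \<open>The incircle argument with \<open>a\<close> equal to minus the length of the first side.
  The same formulas now give \<open>e < 0\<close> and \<open>f > 1\<close>, so two contacts move to
  the extensions beyond the third and second vertex.\<close>

lemma excircle_coordinates:
  fixes x1 y1 x2 y2 x3 y3 :: "'a::ordered_pythagorean_field"
  assumes len: "a ^ 2 = (x3 - x2) ^ 2 + (y3 - y2) ^ 2"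
      "b ^ 2 = (x1 - x3) ^ 2 + (y1 - y3) ^ 2"
      "c ^ 2 = (x2 - x1) ^ 2 + (y2 - y1) ^ 2"
    and pos: "a < 0" "0 < b" "0 < c" "- a < b + c" "b < c - a" "c < b - a"
    and \<Delta>: "\<Delta> = (x2 - x1) * (y3 - y1) - (y2 - y1) * (x3 - x1)" "\<Delta> \<noteq> 0"
    and s: "s = a + b + c"
    and i: "i1 * s = a * x1 + b * x2 + c * x3" "i2 * s = a * y1 + b * y2 + c * y3"
  shows "excircle (x1, y1) (x2, y2) (x3, y3) = circle (i1, i2) \<bar>\<Delta> / s\<bar>"
proof -
  have ne: "(x2, y2) \<noteq> (x3, y3)" "(x3, y3) \<noteq> (x1, y1)" "(x1, y1) \<noteq> (x2, y2)"
    using \<Delta> by (auto simp: algebra_simps)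
  have s0: "s \<noteq> 0" using pos s by simp
  define d e f where def: "d = (a + c - b) / (2 * a)" "e = (b + a - c) / (2 * b)"
    "f = (c + b - a) / (2 * c)"
  have defs: "2 * (d * a) = a + c - b" "2 * (e * b) = b + a - c" "2 * (f * c) = c + b - a"
    using pos by (simp_all add: def)
  have rng: "0 < d" "d < 1" "e < 0" "1 < f"
    using pos by (simp_all add: def field_simps)
  have T1: "tangent_line_at (line (x2, y2) (x3, y3)) (circle (i1, i2) \<bar>\<Delta> / s\<bar>)
    (x2 + d * (x3 - x2), y2 + d * (y3 - y2))"
    by (rule tangent_at_contact_point[OF len \<Delta> s s0 i defs(1)])
  have \<Delta>': "\<Delta> = (x3 - x2) * (y1 - y2) - (y3 - y2) * (x1 - x2)"
    "\<Delta> = (x1 - x3) * (y2 - y3) - (y1 - y3) * (x2 - x3)"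
    unfolding \<Delta>(1) by algebra+
  have T2: "tangent_line_at (line (x1, y1) (x3, y3)) (circle (i1, i2) \<bar>\<Delta> / s\<bar>)
    (x3 + e * (x1 - x3), y3 + e * (y1 - y3))"
    unfolding line_commute[of "(x1, y1)"]
    by (rule tangent_at_contact_point[OF len(2,3,1) \<Delta>'(1) \<Delta>(2) _ s0 _ _ defs(2)])
      (simp_all add: i, simp_all add: s)
  have T3: "tangent_line_at (line (x1, y1) (x2, y2)) (circle (i1, i2) \<bar>\<Delta> / s\<bar>)
    (x1 + f * (x2 - x1), y1 + f * (y2 - y1))"
    by (rule tangent_at_contact_point[OF len(3,1,2) \<Delta>'(2) \<Delta>(2) _ s0 _ _ defs(3)])
      (simp_all add: i, simp_all add: s)
  have circ: "is_circle (circle (i1, i2) \<bar>\<Delta> / s\<bar>)"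
    using \<Delta>(2) s0 zero_less_abs_iff unfolding is_circle_def by (metis divide_eq_0_iff)
  \<comment> \<open>\<open>excircle\<close> measures the second side from the first vertex, the
    contact lemmas from the third; the parameter changes to its complement.\<close>
  have flip: "(x3 + t * (x1 - x3), y3 + t * (y1 - y3)) =
    (x1 + (1 - t) * (x3 - x1), y1 + (1 - t) * (y3 - y1))" for t
    by (simp add: algebra_simps)
  have B: "between (x2, y2) (x2 + d * (x3 - x2), y2 + d * (y3 - y2)) (x3, y3)"
    unfolding between_coordinates using ne rng by blast
  have B': "between (x1, y1) (x3, y3) (x3 + e * (x1 - x3), y3 + e * (y1 - y3))"
    unfolding between_beyond flip using ne rng
    by (intro conjI exI[of _ "1 - e"]) auto
  have B'': "between (x1, y1) (x2, y2) (x1 + f * (x2 - x1), y1 + f * (y2 - y1))"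
    unfolding between_beyond using ne rng by blast
  show ?thesis unfolding excircle_def
  proof (rule the_equality)
    fix \<gamma> assume g: "is_circle \<gamma> \<and>
      (\<exists>D. between (x2, y2) D (x3, y3) \<and> tangent_line_at (line (x2, y2) (x3, y3)) \<gamma> D) \<and>
      (\<exists>E. between (x1, y1) (x3, y3) E \<and> tangent_line_at (line (x1, y1) (x3, y3)) \<gamma> E) \<and>
      (\<exists>F. between (x1, y1) (x2, y2) F \<and> tangent_line_at (line (x1, y1) (x2, y2)) \<gamma> F)"
    then obtain z w r where r: "0 < r" and \<gamma>: "\<gamma> = circle (z, w) r"
      unfolding is_circle_def by (metis surj_pair)
    from g obtain d' k f' where t: "0 < d'" "d' < 1" "1 < k" "1 < f'"
      and T: "tangent_line_at (line (x2, y2) (x3, y3)) \<gamma> (x2 + d' * (x3 - x2), y2 + d' * (y3 - y2))"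
      "tangent_line_at (line (x3, y3) (x1, y1)) \<gamma> (x1 + k * (x3 - x1), y1 + k * (y3 - y1))"
      "tangent_line_at (line (x1, y1) (x2, y2)) \<gamma> (x1 + f' * (x2 - x1), y1 + f' * (y2 - y1))"
      unfolding between_coordinates between_beyond line_commute[of "(x1, y1)" "(x3, y3)"] by auto
    have T2': "tangent_line_at (line (x3, y3) (x1, y1)) \<gamma>
      (x3 + (1 - k) * (x1 - x3), y3 + (1 - k) * (y1 - y3))"
      unfolding flip using T(2) by simp
    \<comment> \<open>In the sign conditions the negative factors \<open>a\<close>,
      \<open>1 - f'\<close> and \<open>1 - k\<close> occur only in pairs.\<close>
    show "\<gamma> = circle (i1, i2) \<bar>\<Delta> / s\<bar>"
      unfolding \<gamma>
      by (rule tritangent_circle_unique[OF len \<Delta> s s0 i _ T(1)[unfolded \<gamma>] T2'[unfolded \<gamma>] T(3)[unfolded \<gamma>]])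
        (use r t pos in \<open>auto simp: zero_le_mult_iff mult_le_0_iff\<close>)
  qed (use circ T1 T2 T3 B B' B'' in blast)
qed

section \<open>Feuerbach's theorem\<close>

text \<open>The absolute value absorbs the signs of the lengths and of \<Delta>. The circumcenter is
  passed on because \<open>nine_point_center_distance\<close> is stated through it.\<close>

lemma nine_point_circle_exists:
  fixes x1 y1 x2 y2 x3 y3 :: "'a::ordered_pythagorean_field"
  assumes len: "a ^ 2 = (x3 - x2) ^ 2 + (y3 - y2) ^ 2"
      "b ^ 2 = (x1 - x3) ^ 2 + (y1 - y3) ^ 2"
      "c ^ 2 = (x2 - x1) ^ 2 + (y2 - y1) ^ 2"
    and \<Delta>: "\<Delta> = (x2 - x1) * (y3 - y1) - (y2 - y1) * (x3 - x1)" "\<Delta> \<noteq> 0"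
  obtains n1 n2 o1 o2 R2 where
    "nine_point_circle (x1, y1) (x2, y2) (x3, y3) = circle (n1, n2) \<bar>a * b * c / (4 * \<Delta>)\<bar>"
    "(x1 - o1) ^ 2 + (y1 - o2) ^ 2 = R2" "(x2 - o1) ^ 2 + (y2 - o2) ^ 2 = R2"
    "(x3 - o1) ^ 2 + (y3 - o2) ^ 2 = R2"
    "2 * n1 = x1 + x2 + x3 - o1" "2 * n2 = y1 + y2 + y3 - o2"
proof -
  obtain o1 o2 R2 where o: "(x1 - o1) ^ 2 + (y1 - o2) ^ 2 = R2"
    "(x2 - o1) ^ 2 + (y2 - o2) ^ 2 = R2" "(x3 - o1) ^ 2 + (y3 - o2) ^ 2 = R2"
    using circumcenter_exists \<Delta> by blast
  define n1 n2 where "n1 = (x1 + x2 + x3 - o1) / 2" and "n2 = (y1 + y2 + y3 - o2) / 2"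
  then have n: "2 * n1 = x1 + x2 + x3 - o1" "2 * n2 = y1 + y2 + y3 - o2" by simp_all
  have "(x2, y2) \<noteq> (x3, y3)" "(x3, y3) \<noteq> (x1, y1)" "(x1, y1) \<noteq> (x2, y2)"
    using \<Delta> by (auto simp: algebra_simps)
  then have abc: "a \<noteq> 0" "b \<noteq> 0" "c \<noteq> 0" using len by (auto simp: sum_power2_eq_zero_iff)
  have "4 * \<Delta> ^ 2 * R2 = a ^ 2 * b ^ 2 * c ^ 2"
    using circumradius_squared[OF o] unfolding len \<Delta>(1) .
  then have "4 * \<bar>a * b * c / (4 * \<Delta>)\<bar> ^ 2 = R2"
    using \<Delta>(2) by (simp add: power_divide power_mult_distrib field_simps)
  moreover have "0 < \<bar>a * b * c / (4 * \<Delta>)\<bar>" using abc \<Delta>(2) by simp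
  ultimately show ?thesis
    using that nine_point_circle_coordinates[OF _ o _ _ n] \<Delta> o n by blast
qed

text \<open>The triangle inequalities are read off Heron's formula, whose right-hand side is
  positive for a nonzero area.\<close>

lemma side_lengths:
  fixes x1 y1 x2 y2 x3 y3 :: "'a::ordered_pythagorean_field"
  defines "a \<equiv> distance (x2, y2) (x3, y3)"
    and "b \<equiv> distance (x3, y3) (x1, y1)"
    and "c \<equiv> distance (x1, y1) (x2, y2)"
  assumes \<Delta>: "(x2 - x1) * (y3 - y1) - (y2 - y1) * (x3 - x1) \<noteq> 0"
  shows "a ^ 2 = (x3 - x2) ^ 2 + (y3 - y2) ^ 2"
      "b ^ 2 = (x1 - x3) ^ 2 + (y1 - y3) ^ 2"
      "c ^ 2 = (x2 - x1) ^ 2 + (y2 - y1) ^ 2"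
    and "0 < a" "0 < b" "0 < c" "a < b + c" "b < c + a" "c < a + b"
proof -
  show len: "a ^ 2 = (x3 - x2) ^ 2 + (y3 - y2) ^ 2"
      "b ^ 2 = (x1 - x3) ^ 2 + (y1 - y3) ^ 2"
      "c ^ 2 = (x2 - x1) ^ 2 + (y2 - y1) ^ 2"
    unfolding a_def b_def c_def by (simp_all add: distance_properties power2_commute)
  have "(x2, y2) \<noteq> (x3, y3)" "(x3, y3) \<noteq> (x1, y1)" "(x1, y1) \<noteq> (x2, y2)"
    using \<Delta> by (auto simp: algebra_simps)
  then have "a \<noteq> 0" "b \<noteq> 0" "c \<noteq> 0" using len by (auto simp: sum_power2_eq_zero_iff)
  moreover have "0 \<le> a" "0 \<le> b" "0 \<le> c" by (simp_all add: a_def b_def c_def distance_properties)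
  ultimately show p: "0 < a" "0 < b" "0 < c" by simp_all
  have "0 < (a + b + c) * (- a + b + c) * (a - b + c) * (a + b - c)"
    unfolding heron[OF len] using \<Delta> by simp
  from triangle_inequalities[OF p this] show "a < b + c" "b < c + a" "c < a + b" .
qed

lemma nine_point_circle_tangent_excircle:
  fixes A B C :: "'a::ordered_pythagorean_field point"
  assumes "triangle A B C"
  shows "tangent_circles (nine_point_circle A B C) (excircle A B C)"
proof -
  obtain x1 y1 x2 y2 x3 y3 where P: "A = (x1, y1)" "B = (x2, y2)" "C = (x3, y3)"
    by fastforce
  define \<Delta> where \<Delta>1: "\<Delta> = (x2 - x1) * (y3 - y1) - (y2 - y1) * (x3 - x1)"
  have \<Delta>2: "\<Delta> \<noteq> 0" using assms unfolding P triangle_coordinates \<Delta>1 .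
  define a b c where "a = - distance (x2, y2) (x3, y3)" and "b = distance (x3, y3) (x1, y1)"
    and "c = distance (x1, y1) (x2, y2)"
  note sides = side_lengths[OF \<Delta>2[unfolded \<Delta>1]]
  have len: "a ^ 2 = (x3 - x2) ^ 2 + (y3 - y2) ^ 2"
      "b ^ 2 = (x1 - x3) ^ 2 + (y1 - y3) ^ 2"
      "c ^ 2 = (x2 - x1) ^ 2 + (y2 - y1) ^ 2"
    using sides(1-3) by (simp_all add: a_def b_def c_def)
  have pos: "a < 0" "0 < b" "0 < c" "- a < b + c" "b < c - a" "c < b - a"
    using sides(4-9) by (simp_all add: a_def b_def c_def)
  define s where s: "s = a + b + c"
  have s0: "0 < s" using pos by (simp add: s)
  define i1 i2 where "i1 = (a * x1 + b * x2 + c * x3) / s" and "i2 = (a * y1 + b * y2 + c * y3) / s"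
  then have i: "i1 * s = a * x1 + b * x2 + c * x3" "i2 * s = a * y1 + b * y2 + c * y3"
    using s0 by simp_all
  obtain n1 n2 o1 o2 R2 where
    N: "nine_point_circle (x1, y1) (x2, y2) (x3, y3) = circle (n1, n2) \<bar>a * b * c / (4 * \<Delta>)\<bar>"
    and o: "(x1 - o1) ^ 2 + (y1 - o2) ^ 2 = R2" "(x2 - o1) ^ 2 + (y2 - o2) ^ 2 = R2"
    "(x3 - o1) ^ 2 + (y3 - o2) ^ 2 = R2"
    and n: "2 * n1 = x1 + x2 + x3 - o1" "2 * n2 = y1 + y2 + y3 - o2"
    using nine_point_circle_exists[OF len \<Delta>1 \<Delta>2] .
  \<comment> \<open>One negative length gives the signed radii opposite signs, so they differ and
    the tangency is external.\<close>
  have opposite: "a * b * c / (4 * \<Delta>) * (\<Delta> / s) < 0"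
    using pos(1-3) s0 \<Delta>2 by (simp add: mult_neg_pos divide_neg_pos)
  show ?thesis
    unfolding P N excircle_coordinates[OF len pos \<Delta>1 \<Delta>2 s i]
  proof (rule tangent_circlesI[OF nine_point_center_distance[OF o n len \<Delta>1 \<Delta>2 s _ i]])
    show "a * b * c / (4 * \<Delta>) \<noteq> \<Delta> / s"
    proof
      assume e: "a * b * c / (4 * \<Delta>) = \<Delta> / s"
      show False using opposite unfolding e by (simp only: not_square_less_zero)
    qed
  qed (use pos s0 \<Delta>2 in simp_all)
qed

lemma nine_point_circle_tangent_incircle:
  fixes A B C :: "'a::ordered_pythagorean_field point"
  assumes "triangle A B C" "\<not> equilateral A B C"
  shows "tangent_circles (nine_point_circle A B C) (incircle A B C)"
proof -
  obtain x1 y1 x2 y2 x3 y3 where P: "A = (x1, y1)" "B = (x2, y2)" "C = (x3, y3)"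
    by fastforce
  define \<Delta> where \<Delta>1: "\<Delta> = (x2 - x1) * (y3 - y1) - (y2 - y1) * (x3 - x1)"
  have \<Delta>2: "\<Delta> \<noteq> 0" using assms(1) unfolding P triangle_coordinates \<Delta>1 .
  define a b c where "a = distance (x2, y2) (x3, y3)" and "b = distance (x3, y3) (x1, y1)"
    and "c = distance (x1, y1) (x2, y2)"
  note sides = side_lengths[OF \<Delta>2[unfolded \<Delta>1], folded a_def b_def c_def]
  note len = sides(1-3) and pos = sides(4-9)
  define s where s: "s = a + b + c"
  have s0: "0 < s" using pos by (simp add: s)
  define i1 i2 where "i1 = (a * x1 + b * x2 + c * x3) / s" and "i2 = (a * y1 + b * y2 + c * y3) / s"
  then have i: "i1 * s = a * x1 + b * x2 + c * x3" "i2 * s = a * y1 + b * y2 + c * y3"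
    using s0 by simp_all
  obtain n1 n2 o1 o2 R2 where
    N: "nine_point_circle (x1, y1) (x2, y2) (x3, y3) = circle (n1, n2) \<bar>a * b * c / (4 * \<Delta>)\<bar>"
    and o: "(x1 - o1) ^ 2 + (y1 - o2) ^ 2 = R2" "(x2 - o1) ^ 2 + (y2 - o2) ^ 2 = R2"
    "(x3 - o1) ^ 2 + (y3 - o2) ^ 2 = R2"
    and n: "2 * n1 = x1 + x2 + x3 - o1" "2 * n2 = y1 + y2 + y3 - o2"
    using nine_point_circle_exists[OF len \<Delta>1 \<Delta>2] .
  show ?thesis
    unfolding P N incircle_coordinates[OF len pos \<Delta>1 \<Delta>2 s i]
  proof (rule tangent_circlesI[OF nine_point_center_distance[OF o n len \<Delta>1 \<Delta>2 s _ i]])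
    show "a * b * c / (4 * \<Delta>) \<noteq> \<Delta> / s"
    proof
      assume "a * b * c / (4 * \<Delta>) = \<Delta> / s"
      \<comment> \<open>Equal radii mean, after clearing denominators and cancelling
        \<open>s\<close> from Heron's formula, the equality case of Euler's inequality.\<close>
      then have "a * b * c * s = 4 * \<Delta> ^ 2"
        using s0 \<Delta>2 by (simp add: frac_eq_eq power2_eq_square mult_ac)
      also have "\<dots> = (- a + b + c) * (a - b + c) * (a + b - c) * s"
        unfolding \<Delta>1 heron[OF len, symmetric] s by algebra
      finally have "a * b * c = (- a + b + c) * (a - b + c) * (a + b - c)"
        using s0 by simp
      then have "a = b" "b = c"
        using equal_sides_if_product pos(4-6) by blast+
      then show False using assms(2) unfolding P equilateral_def a_def b_def c_def by simp
    qed
  qed (use pos s0 \<Delta>2 in simp_all)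
qed

lemma triangle_rotate: "triangle A B C \<Longrightarrow> triangle B C A"
  unfolding triangle_def by blast

theorem mainTheorem3:
  fixes A B C :: "'a::ordered_pythagorean_field point"
  assumes "triangle A B C"
    and "\<not> equilateral A B C"
  shows "tangent_circles (nine_point_circle A B C) (incircle A B C) \<and>
    tangent_circles (nine_point_circle A B C) (excircle A B C) \<and>
    tangent_circles (nine_point_circle A B C) (excircle B C A) \<and>
    tangent_circles (nine_point_circle A B C) (excircle C A B)"
proof -
  have BCA: "triangle B C A" and CAB: "triangle C A B"
    using assms(1) triangle_rotate by blast+
  have "tangent_circles (nine_point_circle A B C) (excircle B C A)"
    using nine_point_circle_tangent_excircle[OF BCA] by (simp only: nine_point_circle_rotate)
  \<comment> \<open>Two rotations are involved; both circles are rewritten to the common form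
    \<open>nine_point_circle B C A\<close>.\<close>
  moreover have "tangent_circles (nine_point_circle A B C) (excircle C A B)"
    using nine_point_circle_tangent_excircle[OF CAB]
    by (simp only: nine_point_circle_rotate[of A B C, symmetric] nine_point_circle_rotate[of B C A])
  ultimately show ?thesis
    using nine_point_circle_tangent_incircle[OF assms] nine_point_circle_tangent_excircle[OF assms(1)]
    by blast
qed

end
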